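(* Let $\Theta\subset\mathbb{R}^q$ be a known compact set and $\theta\in\Theta$ an uncertain constant parameter. Consider the system $\dot x=f_1(x)+\phi(\theta,x)+g_1(x)u$, $x\in\mathbb{R}^n$, $u\in\mathbb{R}^m$, with parameter estimator $$\dot{\hat\theta}=-\frac{\partial\beta}{\partial e}\big[f_1(x)+\phi(\mathrm{satv}(\hat\theta+\beta),x)+g_1(x)u-\dot x_r\big]-\frac{\partial\beta}{\partial x_r}\dot x_r-k_{dz}\,\mathrm{dzv}(\hat\theta+\beta)$$ and feedback controller $u=\psi(x_r,\dot x_r,\mathrm{satv}(\hat\theta+\beta),e)$, where $e=x-x_r(t)$ and $\beta=\beta(e,x_r)=\int_0^e\varsigma(s+x_r)\,ds$, i.e. $\frac{\partial\beta}{\partial e}(e,x_r)=\varsigma(e+x_r)$. Suppose that Assumptions 1–4 stated in the context hold, and that $$\alpha_3(s)\ \ge\ \tau_{err}\;\gamma_s\Big(a^\ast l_\gamma\,\kappa_2\big(\alpha_1^{-1}(\alpha_2(s))\big)\Big)\cdot\alpha_4(s)\cdot\kappa_1(s)\qquad\text{for all } s\in\mathbb{R}_+$$ is satisfied with a constant $\tau_{err}>4$, with $\alpha_i,\gamma_s,l_\gamma,\kappa_1,\kappa_2,a^\ast$ as in the context. Then the resulting closed-loop error system in the coordinates $e=x-x_r$, $\tilde\theta=\hat\theta-\theta+\beta(e,x_r)$, $$\dot e=F(x_r,\dot x_r,\mathrm{satv}(\theta+\tilde\theta),e)-\tilde\phi_s(\theta,\tilde\theta,e+x_r),\qquad \dot{\tilde\theta}=H(\theta,\tilde\theta,x_r)+\Delta(\theta,\tilde\theta,x_r,e),$$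 permits a smooth strict Lyapunov function having the sum-type form $$V_{cl}(t,e,\tilde\theta)=\int_0^{V_{err}(t,e)}\lambda_{err}(s)\,ds+\int_0^{V_{est}(t,\tilde\theta)}\lambda_{est}(s)\,ds$$ with $\lambda_{err},\lambda_{est}\in\mathcal{K}$, where $V_{err}$ and $V_{est}$ are the functions introduced in the context.
   Context: Notation. $|\cdot|$ is the Euclidean norm (induced norm for matrices), $\mathbb{B}_r^k=\{x\in\mathbb{R}^k:|x|\le r\}$, $\mathbb{R}_+=[0,\infty)$. $\mathcal{SN}$: continuous nondecreasing functions $\mathbb{R}_+\to\mathbb{R}_+$. $\mathcal{K}$: strictly increasing functions in $\mathcal{SN}$ vanishing at $0$. $\mathcal{K}_\infty$: unbounded functions in $\mathcal{K}$. A strict Lyapunov function is meant in the usual sense for time-varying systems: bounded below and above by class-$\mathcal{K}_\infty$ functions of the state norm, with derivative along the system bounded above by a negative definite function of the state. Saturation and dead zone. $l_\theta\ge\max_{\theta\in\Theta}|\theta|$; saturation level $l_s>l_\theta$ (chosen as in Assumption 3), margin $0<\epsilon_s\le1$. $\mathrm{sat}(s)=s$ if $|s|\le l_s$; $\mathrm{sat}(s)=s-\mathrm{sign}(s)\frac{(|s|-l_s)^2}{2\epsilon_s}$ if $l_s\le|s|\le l_s+\epsilon_s$; $\mathrm{sat}(s)=(l_s+0.5\epsilon_s)\mathrm{sign}(s)$ if $|s|\ge l_s+\epsilon_s$. $\mathrm{dz}(s)=0$ if $|s|\le l_\theta$; $\mathrm{dz}(s)=(|s|-l_\theta)^2[2(l_\theta+1)^2-(2l_\theta+1)|s|]\,\mathrm{sign}(s)$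 if $l_\theta<|s|<l_\theta+1$; $\mathrm{dz}(s)=s$ if $|s|\ge l_\theta+1$. $\mathrm{satv}$ and $\mathrm{dzv}$ apply $\mathrm{sat}$ and $\mathrm{dz}$ componentwise on $\mathbb{R}^q$. Assumption 1. $\phi(\theta,x)$ is $C^1$ in $\theta\in\mathbb{R}^q$, for all $x\in\mathbb{R}^n$. Assumption 2. The reference $x_r(t)$ is $C^1$; there is $r_1>0$ with $x_r(t)\in\mathbb{B}_{r_1}^n$ for all $t\ge0$; $x_r(t)$ and $\dot x_r(t)$ are known a priori. Assumption 3. There exist $l_s>\sqrt q\,l_\theta$ and a continuous $\varsigma:\mathbb{R}^n\to\mathbb{R}^{q\times n}$ such that $(\theta'-\theta)^\top\varsigma(x_r)[\phi(\theta',x_r)-\phi(\theta,x_r)]\ge(\theta'-\theta)^\top M_1(x_r)(\theta'-\theta)\ge0$ for all $\theta\in\Theta$ and $|\theta'|\le l_s$ (with $x_r=x_r(t)$ the reference), for some continuous $M_1:\mathbb{R}^n\to\mathbb{R}^{q\times q}$ satisfying $\int_t^{t+\delta}\big(M_1(x_r(\tau))+M_1^\top(x_r(\tau))\big)d\tau\ge\mu I$ for some constants $\delta,\mu>0$ and all $t\ge0$. Assumption 4. There is a function $\psi(x_r,\dot x_r,\theta,e)$ such that, with $F(x_r,\dot x_r,\theta,e)=f_1(e+x_r)+\phi(\theta,e+x_r)+g_1(e+x_r)\psi(x_r,\dot x_r,\theta,e)-\dot x_r$, the zero equilibrium of $\dot e=F(x_r,\dot x_r,\theta,e)$ is globally asymptotically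 stable, uniformly in $t\in\mathbb{R}_+$ and $\theta\in\mathbb{R}^q$; more specifically, there are a strict Lyapunov function $V_{err}(t,e)$ and $\alpha_1,\dots,\alpha_4\in\mathcal{K}_\infty$ such that for all $\theta\in\mathbb{R}^q$: $\alpha_1(|e|)\le V_{err}(t,e)\le\alpha_2(|e|)$, $\frac{\partial V_{err}}{\partial t}+\frac{\partial V_{err}}{\partial e}F(x_r,\dot x_r,\theta,e)\le-\alpha_3(|e|)$, $\left|\frac{\partial V_{err}}{\partial e}\right|\le\alpha_4(|e|)$. Derived objects. $\tilde\phi_s(\theta^\dag,\theta^\ddag,x)=\phi(\mathrm{satv}(\theta^\dag+\theta^\ddag),x)-\phi(\mathrm{satv}(\theta^\dag),x)$. $\gamma_s\in\mathcal{K}\setminus\mathcal{K}_\infty$ and the constant $l_\gamma>0$ satisfy $\gamma_s(s)\le l_\gamma$, $\gamma_s(s)\le s$ for all $s\ge0$, and $|\mathrm{satv}(\theta+\tilde\theta)-\theta|\le\gamma_s(|\tilde\theta|)$ for all $\theta\in\Theta$, $\tilde\theta\in\mathbb{R}^q$. $\kappa_1\in\mathcal{SN}$ is such that $\kappa_1(s)\ge\sup\left|\frac{\partial\phi(\theta,e+x_r)}{\partial\theta}\right|$, the supremum being over $(\theta,x_r,e)\in\mathbb{B}^q_{l_s+0.5\epsilon_s}\times\mathbb{B}_{r_1}^n\times\mathbb{B}_s^n$. With $\varphi(\theta^\dag,x_r,e^\dag)=\varsigma(x_r)\phi(\theta^\dag,x_r)-\varsigma(e^\dag)\phi(\theta^\dag,e^\dag)$,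 $\kappa_2\in\mathcal{K}$ is a function (whose existence the paper derives from Assumptions 1 and 2) such that $|\varphi(\theta^\dag,x_r,e+x_r)-\varphi(\theta^\ddag,x_r,e+x_r)|\le\kappa_2(|e|)|\theta^\dag-\theta^\ddag|$ for all $x_r\in\mathbb{B}_{r_1}^n$, $e\in\mathbb{R}^n$, $\theta^\dag,\theta^\ddag\in\mathbb{B}^q_{l_s+0.5\epsilon_s}$. $H(\theta,\tilde\theta,x_r)=-\varsigma(x_r)\tilde\phi_s(\theta,\tilde\theta,x_r)-k_{dz}\,\mathrm{dzv}(\tilde\theta+\theta)$ and $\Delta(\theta,\tilde\theta,x_r,e)=\varphi(\mathrm{satv}(\theta),x_r,e+x_r)-\varphi(\mathrm{satv}(\theta+\tilde\theta),x_r,e+x_r)$. Choice of $k_{dz}$, $V_{est}$ and constants $a_i$. The paper derives from Assumptions 1–3 that there is $k_{dz}^\star>0$ such that for all $k_{dz}\ge k_{dz}^\star$ there are a $C^1$ function $V_{est}:\mathbb{R}_+\times\mathbb{R}^q\to\mathbb{R}_+$ and constants $a_1,\dots,a_4>0$ with $a_1|\tilde\theta|^2\le V_{est}(t,\tilde\theta)\le a_2|\tilde\theta|^2$, $\frac{\partial V_{est}}{\partial t}+\frac{\partial V_{est}}{\partial\tilde\theta}H(\theta,\tilde\theta,x_r)\le-a_3|\tilde\theta|^2$, $\left|\frac{\partial V_{est}}{\partial\tilde\theta}\right|\le a_4|\tilde\theta|$. The design gain is fixed with $k_{dz}\ge k_{dz}^\star$, $V_{est}$ and the $a_i$ are this function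 and these constants, and $a^\ast=\frac{\sqrt{a_2}\,a_4}{\sqrt{a_1}\,a_3}$.
   Formalization: Adds: for some s_0, γ_s(s) ≤ τ_err γ_s(a* l_γ κ_2(α_1^{-1}(α_2(s_0)))) for all s (automatic if κ_2 is unbounded); the conditions on κ_1, κ_2 range over the box |θ_i| ≤ l_s+0.5ε_s, not the ball. Without these the claim is false. Also proved with −Δ, the true closed-loop sign. *)

theory Defs
  imports "HOL-Analysis.Analysis"
begin

(* Comparison functions are total functions on the reals of which only the values on {0..} matter. *)

definition class_SN :: "(real \<Rightarrow> real) \<Rightarrow> bool" where
  "class_SN f \<longleftrightarrow> continuous_on {0..} f \<and> mono_on {0..} f \<and> (\<forall>s\<ge>0. 0 \<le> f s)"

definition class_K :: "(real \<Rightarrow> real) \<Rightarrow> bool" where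
  "class_K f \<longleftrightarrow> class_SN f \<and> strict_mono_on {0..} f \<and> f 0 = 0"

definition class_Kinf :: "(real \<Rightarrow> real) \<Rightarrow> bool" where
  "class_Kinf f \<longleftrightarrow> class_K f \<and> (\<forall>b. \<exists>s\<ge>0. b < f s)"

(* V : [0,oo) x E -> R is C^1 with time derivative Vt and state gradient Vx; at t = 0 the
   time derivative is one-sided. *)
definition C1_time_state ::
  "(real \<Rightarrow> 'a::euclidean_space \<Rightarrow> real) \<Rightarrow> (real \<Rightarrow> 'a \<Rightarrow> real) \<Rightarrow> (real \<Rightarrow> 'a \<Rightarrow> 'a) \<Rightarrow> bool" where
  "C1_time_state V Vt Vx \<longleftrightarrow>
     (\<forall>t\<ge>0. \<forall>z. ((\<lambda>p. V (fst p) (snd p)) has_derivative (\<lambda>h. fst h * Vt t z + Vx t z \<bullet> snd h))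
                    (at (t, z) within {0..} \<times> UNIV)) \<and>
     continuous_on ({0..} \<times> UNIV) (\<lambda>p. Vt (fst p) (snd p)) \<and>
     continuous_on ({0..} \<times> UNIV) (\<lambda>p. Vx (fst p) (snd p))"

definition pos_def :: "('a::euclidean_space \<Rightarrow> real) \<Rightarrow> bool" where
  "pos_def W \<longleftrightarrow> continuous_on UNIV W \<and> W 0 = 0 \<and> (\<forall>z. z \<noteq> 0 \<longrightarrow> 0 < W z)"

(* C^1 strict Lyapunov function for the family z' = f p t z, p in P, with bounds that are
   uniform in the parameter p. *)
definition strict_lyapunov ::
  "'p set \<Rightarrow> ('p \<Rightarrow> real \<Rightarrow> 'a::euclidean_space \<Rightarrow> 'a) \<Rightarrow> (real \<Rightarrow> 'a \<Rightarrow> real) \<Rightarrow> bool" where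
  "strict_lyapunov P f V \<longleftrightarrow>
     (\<exists>Vt Vx b1 b2 W.
        C1_time_state V Vt Vx \<and> class_Kinf b1 \<and> class_Kinf b2 \<and> pos_def W \<and>
        (\<forall>t\<ge>0. \<forall>z. b1 (norm z) \<le> V t z \<and> V t z \<le> b2 (norm z)) \<and>
        (\<forall>p\<in>P. \<forall>t\<ge>0. \<forall>z. Vt t z + Vx t z \<bullet> f p t z \<le> - W z))"

definition sat :: "real \<Rightarrow> real \<Rightarrow> real \<Rightarrow> real" where
  "sat ls eps s =
     (if \<bar>s\<bar> \<le> ls then s
      else if \<bar>s\<bar> \<le> ls + eps then s - sgn s * ((\<bar>s\<bar> - ls)\<^sup>2 / (2 * eps))
      else (ls + eps / 2) * sgn s)"

definition dz :: "real \<Rightarrow> real \<Rightarrow> real" where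
  "dz lt s =
     (if \<bar>s\<bar> \<le> lt then 0
      else if \<bar>s\<bar> < lt + 1 then (\<bar>s\<bar> - lt)\<^sup>2 * (2 * (lt + 1)\<^sup>2 - (2 * lt + 1) * \<bar>s\<bar>) * sgn s
      else s)"

definition satv :: "real \<Rightarrow> real \<Rightarrow> real^'q \<Rightarrow> real^'q" where
  "satv ls eps p = (\<chi> i. sat ls eps (p $ i))"

definition dzv :: "real \<Rightarrow> real^'q \<Rightarrow> real^'q" where
  "dzv lt p = (\<chi> i. dz lt (p $ i))"

(* The values of satv ls eps fill this box. For q \<ge> 2 they are not contained in the Euclidean
   ball of radius ls + eps / 2; for q = 1 box and ball coincide. *)
definition sat_box :: "real \<Rightarrow> real \<Rightarrow> (real^'q) set" where
  "sat_box ls eps = {p. \<forall>i. \<bar>p $ i\<bar> \<le> ls + eps / 2}"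

definition phi_s ::
  "(real^'q \<Rightarrow> real^'n \<Rightarrow> real^'n) \<Rightarrow> real \<Rightarrow> real \<Rightarrow> real^'q \<Rightarrow> real^'q \<Rightarrow> real^'n \<Rightarrow> real^'n" where
  "phi_s \<phi> ls eps p p' x = \<phi> (satv ls eps (p + p')) x - \<phi> (satv ls eps p) x"

definition varphi ::
  "(real^'q \<Rightarrow> real^'n \<Rightarrow> real^'n) \<Rightarrow> (real^'n \<Rightarrow> real^'n^'q) \<Rightarrow>
   real^'q \<Rightarrow> real^'n \<Rightarrow> real^'n \<Rightarrow> real^'q" where
  "varphi \<phi> \<sigma> p xr y = \<sigma> xr *v \<phi> p xr - \<sigma> y *v \<phi> p y"

definition F_err ::
  "(real^'n \<Rightarrow> real^'n) \<Rightarrow> (real^'q \<Rightarrow> real^'n \<Rightarrow> real^'n) \<Rightarrow> (real^'n \<Rightarrow> real^'m^'n) \<Rightarrow>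
   (real^'n \<Rightarrow> real^'n \<Rightarrow> real^'q \<Rightarrow> real^'n \<Rightarrow> real^'m) \<Rightarrow>
   real^'n \<Rightarrow> real^'n \<Rightarrow> real^'q \<Rightarrow> real^'n \<Rightarrow> real^'n" where
  "F_err f1 \<phi> g1 \<psi> xr dxr p e =
     f1 (e + xr) + \<phi> p (e + xr) + g1 (e + xr) *v \<psi> xr dxr p e - dxr"

definition H_est ::
  "(real^'q \<Rightarrow> real^'n \<Rightarrow> real^'n) \<Rightarrow> (real^'n \<Rightarrow> real^'n^'q) \<Rightarrow> real \<Rightarrow> real \<Rightarrow> real \<Rightarrow> real \<Rightarrow>
   real^'q \<Rightarrow> real^'q \<Rightarrow> real^'n \<Rightarrow> real^'q" where
  "H_est \<phi> \<sigma> lt ls eps kdz p p' xr =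
     - (\<sigma> xr *v phi_s \<phi> ls eps p p' xr) - kdz *\<^sub>R dzv lt (p' + p)"

definition Delta ::
  "(real^'q \<Rightarrow> real^'n \<Rightarrow> real^'n) \<Rightarrow> (real^'n \<Rightarrow> real^'n^'q) \<Rightarrow> real \<Rightarrow> real \<Rightarrow>
   real^'q \<Rightarrow> real^'q \<Rightarrow> real^'n \<Rightarrow> real^'n \<Rightarrow> real^'q" where
  "Delta \<phi> \<sigma> ls eps p p' xr e =
     varphi \<phi> \<sigma> (satv ls eps p) xr (e + xr) - varphi \<phi> \<sigma> (satv ls eps (p + p')) xr (e + xr)"

(* The integral of the matrix field \<sigma> (s + xr) from s = 0 to s = e, taken along the segment. *)
definition beta :: "(real^'n \<Rightarrow> real^'n^'q) \<Rightarrow> real^'n \<Rightarrow> real^'n \<Rightarrow> real^'q" where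
  "beta \<sigma> e xr = integral {0..1} (\<lambda>s. \<sigma> (s *\<^sub>R e + xr) *v e)"

definition plant ::
  "(real^'n \<Rightarrow> real^'n) \<Rightarrow> (real^'q \<Rightarrow> real^'n \<Rightarrow> real^'n) \<Rightarrow> (real^'n \<Rightarrow> real^'m^'n) \<Rightarrow>
   real^'q \<Rightarrow> real^'n \<Rightarrow> real^'m \<Rightarrow> real^'n" where
  "plant f1 \<phi> g1 p x u = f1 x + \<phi> p x + g1 x *v u"

definition controller ::
  "(real^'n \<Rightarrow> real^'n \<Rightarrow> real^'q \<Rightarrow> real^'n \<Rightarrow> real^'m) \<Rightarrow> (real^'n \<Rightarrow> real^'n^'q) \<Rightarrow> real \<Rightarrow> real \<Rightarrow>
   real^'n \<Rightarrow> real^'n \<Rightarrow> real^'n \<Rightarrow> real^'q \<Rightarrow> real^'m" where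
  "controller \<psi> \<sigma> ls eps xr dxr x p =
     \<psi> xr dxr (satv ls eps (p + beta \<sigma> (x - xr) xr)) (x - xr)"

definition beta_e :: "(real^'n \<Rightarrow> real^'n^'q) \<Rightarrow> real^'n \<Rightarrow> real^'n \<Rightarrow> real^'n^'q" where
  "beta_e \<sigma> e xr = matrix (frechet_derivative (\<lambda>y. beta \<sigma> y xr) (at e))"

definition beta_xr :: "(real^'n \<Rightarrow> real^'n^'q) \<Rightarrow> real^'n \<Rightarrow> real^'n \<Rightarrow> real^'n^'q" where
  "beta_xr \<sigma> e xr = matrix (frechet_derivative (\<lambda>y. beta \<sigma> e y) (at xr))"

(* Right-hand side of the estimator at plant state x, estimator state p and input u. *)
definition estimator ::
  "(real^'n \<Rightarrow> real^'n) \<Rightarrow> (real^'q \<Rightarrow> real^'n \<Rightarrow> real^'n) \<Rightarrow> (real^'n \<Rightarrow> real^'m^'n) \<Rightarrow>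
   (real^'n \<Rightarrow> real^'n^'q) \<Rightarrow> real \<Rightarrow> real \<Rightarrow> real \<Rightarrow> real \<Rightarrow>
   real^'n \<Rightarrow> real^'n \<Rightarrow> real^'n \<Rightarrow> real^'q \<Rightarrow> real^'m \<Rightarrow> real^'q" where
  "estimator f1 \<phi> g1 \<sigma> lt ls eps kdz xr dxr x p u =
     (let e = x - xr; q = p + beta \<sigma> e xr in
      - (beta_e \<sigma> e xr *v (f1 x + \<phi> (satv ls eps q) x + g1 x *v u - dxr))
      - beta_xr \<sigma> e xr *v dxr - kdz *\<^sub>R dzv lt q)"

(* Plant, estimator and controller in the coordinates (e, p') = (x - xr, q - p + beta (e, xr)),
   q being the estimator state and p the true parameter. *)
definition closed_loop ::
  "(real^'n \<Rightarrow> real^'n) \<Rightarrow> (real^'q \<Rightarrow> real^'n \<Rightarrow> real^'n) \<Rightarrow> (real^'n \<Rightarrow> real^'m^'n) \<Rightarrow>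
   (real^'n \<Rightarrow> real^'n \<Rightarrow> real^'q \<Rightarrow> real^'n \<Rightarrow> real^'m) \<Rightarrow> (real^'n \<Rightarrow> real^'n^'q) \<Rightarrow>
   real \<Rightarrow> real \<Rightarrow> real \<Rightarrow> real \<Rightarrow> (real \<Rightarrow> real^'n) \<Rightarrow> (real \<Rightarrow> real^'n) \<Rightarrow>
   real^'q \<Rightarrow> real \<Rightarrow> (real^'n) \<times> (real^'q) \<Rightarrow> (real^'n) \<times> (real^'q)" where
  "closed_loop f1 \<phi> g1 \<psi> \<sigma> lt ls eps kdz xr dxr p t = (\<lambda>(e, p').
     let x = e + xr t;
         q = p' + p - beta \<sigma> e (xr t);
         u = controller \<psi> \<sigma> ls eps (xr t) (dxr t) x q;
         de = plant f1 \<phi> g1 p x u - dxr t;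
         dq = estimator f1 \<phi> g1 \<sigma> lt ls eps kdz (xr t) (dxr t) x q u
     in (de, dq + beta_e \<sigma> e (xr t) *v de + beta_xr \<sigma> e (xr t) *v dxr t))"

(* The two displayed error equations. Evaluating closed_loop by the chain rule gives the second
   component as H_est - Delta, not H_est + Delta; the sign of Delta is kept as displayed. *)
definition error_system ::
  "(real^'n \<Rightarrow> real^'n) \<Rightarrow> (real^'q \<Rightarrow> real^'n \<Rightarrow> real^'n) \<Rightarrow> (real^'n \<Rightarrow> real^'m^'n) \<Rightarrow>
   (real^'n \<Rightarrow> real^'n \<Rightarrow> real^'q \<Rightarrow> real^'n \<Rightarrow> real^'m) \<Rightarrow> (real^'n \<Rightarrow> real^'n^'q) \<Rightarrow>
   real \<Rightarrow> real \<Rightarrow> real \<Rightarrow> real \<Rightarrow> (real \<Rightarrow> real^'n) \<Rightarrow> (real \<Rightarrow> real^'n) \<Rightarrow>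
   real^'q \<Rightarrow> real \<Rightarrow> (real^'n) \<times> (real^'q) \<Rightarrow> (real^'n) \<times> (real^'q)" where
  "error_system f1 \<phi> g1 \<psi> \<sigma> lt ls eps kdz xr dxr p t = (\<lambda>(e, p').
     (F_err f1 \<phi> g1 \<psi> (xr t) (dxr t) (satv ls eps (p + p')) e - phi_s \<phi> ls eps p p' (e + xr t),
      H_est \<phi> \<sigma> lt ls eps kdz p p' (xr t) + Delta \<phi> \<sigma> ls eps p p' (xr t) e))"

definition V_sum ::
  "(real \<Rightarrow> real) \<Rightarrow> (real \<Rightarrow> real) \<Rightarrow> (real \<Rightarrow> real^'n \<Rightarrow> real) \<Rightarrow> (real \<Rightarrow> real^'q \<Rightarrow> real) \<Rightarrow>
   real \<Rightarrow> (real^'n) \<times> (real^'q) \<Rightarrow> real" where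
  "V_sum lam_err lam_est Verr Vest t = (\<lambda>(e, p').
     integral {0..Verr t e} lam_err + integral {0..Vest t p'} lam_est)"

end

theory Submission
  imports Defs
begin

text \<open>
  Put \<open>X = astar * l\<gamma> * \<kappa>2 (inverse of \<alpha>1 at Verr)\<close>, \<open>Y = sqrt (Vest / a1)\<close> and
  \<open>\<rho> = sqrt (a1 / a2)\<close>, so that \<open>\<rho> Y \<le> r \<le> Y\<close> for \<open>r = norm p'\<close>. With \<open>s = norm e\<close> the derivatives of
  \<open>Verr\<close> and \<open>Vest\<close> along the closed loop are at most \<open>- \<alpha>3 s + \<alpha>4 s * \<kappa>1 s * \<gamma> Y\<close> and
  \<open>- a3 * r * (r - \<rho> X)\<close>, while the gain condition gives \<open>\<tau> * \<alpha>4 s * \<kappa>1 s * \<gamma> X \<le> \<alpha>3 s\<close>. Hence the first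
  can fail to be negative only if \<open>\<gamma> Y\<close> exceeds \<open>\<tau> * \<gamma> X\<close>, the second only if \<open>Y < X\<close>, and these
  regions are separated by a gap. Choosing \<open>lam_err = L\<close> and \<open>lam_est v = M (sqrt (v / a1))\<close> with \<open>M\<close>
  growing fast across the gap, the decreasing summand outweighs the increasing one in either region.
  Only \<open>norm Delta\<close> enters, so the sign with which it occurs is irrelevant.
\<close>

section \<open>Comparison functions of class K and class K-infinity\<close>

lemma class_KI:
  assumes "continuous_on {0..} f" "\<And>x y. 0 \<le> x \<Longrightarrow> x < y \<Longrightarrow> f x < f y" "f 0 = 0"
  shows "class_K f"
proof -
  have "f x \<le> f y" if "0 \<le> x" "x \<le> y" for x y
    using assms(2)[of x y] that by (cases "x = y") auto
  then show ?thesis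
    unfolding class_K_def class_SN_def using assms
    by (auto intro!: mono_onI strict_mono_onI) (metis order_refl)
qed

lemma class_SN_cont: "class_SN f \<Longrightarrow> continuous_on {0..} f"
  and class_SN_mono: "class_SN f \<Longrightarrow> 0 \<le> x \<Longrightarrow> x \<le> y \<Longrightarrow> f x \<le> f y"
  and class_SN_nonneg: "class_SN f \<Longrightarrow> 0 \<le> x \<Longrightarrow> 0 \<le> f x"
  by (auto simp: class_SN_def mono_on_def)

lemma class_K_SN: "class_K f \<Longrightarrow> class_SN f"
  by (simp add: class_K_def)

lemmas class_K_cont = class_SN_cont[OF class_K_SN]
  and class_K_mono = class_SN_mono[OF class_K_SN]
  and class_K_nonneg = class_SN_nonneg[OF class_K_SN]

lemma class_K_zero: "class_K f \<Longrightarrow> f 0 = 0"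
  by (simp add: class_K_def)

lemma class_K_strict: "class_K f \<Longrightarrow> 0 \<le> x \<Longrightarrow> x < y \<Longrightarrow> f x < f y"
  by (auto simp: class_K_def strict_mono_on_def)

lemma class_K_pos: "class_K f \<Longrightarrow> 0 < x \<Longrightarrow> 0 < f x"
  using class_K_strict[of f 0 x] class_K_zero[of f] by simp

lemma class_K_cancel: "class_K f \<Longrightarrow> 0 \<le> y \<Longrightarrow> f x < f y \<Longrightarrow> 0 \<le> x \<Longrightarrow> x < y"
  using class_K_mono[of f y x] by fastforce

lemma class_Kinf_K: "class_Kinf f \<Longrightarrow> class_K f"
  by (simp add: class_Kinf_def)

lemma class_K_comp:
  assumes "class_K f" "class_K g"
  shows "class_K (\<lambda>x. f (g x))"
proof (rule class_KI)
  show "continuous_on {0..} (\<lambda>x. f (g x))"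
    by (rule continuous_on_compose2[OF class_K_cont[OF assms(1)] class_K_cont[OF assms(2)]])
      (auto intro: class_K_nonneg[OF assms(2)])
qed (use assms in \<open>auto intro!: class_K_strict[OF assms(1)] class_K_strict[OF assms(2)]
      class_K_nonneg[OF assms(2)] simp: class_K_zero\<close>)

lemma class_K_add:
  assumes "class_K f" "class_SN g" "g 0 = 0"
  shows "class_K (\<lambda>x. f x + g x)"
proof (rule class_KI)
  show "f x + g x < f y + g y" if "0 \<le> x" "x < y" for x y
    using class_K_strict[OF assms(1) that] class_SN_mono[OF assms(2), of x y] that by simp
qed (use assms in \<open>auto simp: class_K_zero class_K_cont class_SN_cont continuous_on_add\<close>)

lemma class_K_scale: "class_K f \<Longrightarrow> 0 < c \<Longrightarrow> class_K (\<lambda>x. c * f x)"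
  by (rule class_KI) (auto intro: class_K_strict simp: class_K_zero class_K_cont continuous_on_mult_left)

lemma class_K_id: "class_K (\<lambda>x. x)"
  by (rule class_KI) auto

lemma class_Kinf_comp:
  assumes "class_Kinf f" "class_Kinf g"
  shows "class_Kinf (\<lambda>x. f (g x))"
  unfolding class_Kinf_def
proof (intro conjI allI)
  show "class_K (\<lambda>x. f (g x))"
    by (rule class_K_comp[OF assms[THEN class_Kinf_K]])
  fix b
  obtain s where s: "0 \<le> s" "b < f s"
    using assms(1) by (auto simp: class_Kinf_def)
  obtain r where r: "0 \<le> r" "s < g r"
    using assms(2) by (auto simp: class_Kinf_def)
  then show "\<exists>s\<ge>0. b < f (g s)"
    using s class_K_strict[OF class_Kinf_K[OF assms(1)] s(1) r(2)] by (intro exI[of _ r]) auto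
qed

lemma class_Kinf_add:
  assumes "class_Kinf f" "class_K g"
  shows "class_Kinf (\<lambda>x. f x + g x)"
  unfolding class_Kinf_def
proof (intro conjI allI)
  show "class_K (\<lambda>x. f x + g x)"
    using assms by (simp add: class_K_add class_Kinf_K class_K_SN class_K_zero)
  fix b
  obtain s where s: "0 \<le> s" "b < f s"
    using assms(1) by (auto simp: class_Kinf_def)
  then show "\<exists>s\<ge>0. b < f s + g s"
    using class_K_nonneg[OF assms(2), of s] by (intro exI[of _ s]) auto
qed

lemma class_Kinf_min:
  assumes "class_Kinf f" "class_Kinf g"
  shows "class_Kinf (\<lambda>x. min (f x) (g x))"
  unfolding class_Kinf_def
proof (intro conjI allI)
  have K: "class_K f" "class_K g"
    using assms by (auto simp: class_Kinf_K)
  show "class_K (\<lambda>x. min (f x) (g x))"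
  proof (rule class_KI)
    show "min (f x) (g x) < min (f y) (g y)" if "0 \<le> x" "x < y" for x y
      using class_K_strict[OF K(1) that] class_K_strict[OF K(2) that] by auto
  qed (use K in \<open>auto simp: class_K_zero class_K_cont continuous_on_min\<close>)
  fix b
  obtain s where s: "0 \<le> s" "b < f s"
    using assms(1) by (auto simp: class_Kinf_def)
  obtain r where r: "0 \<le> r" "b < g r"
    using assms(2) by (auto simp: class_Kinf_def)
  show "\<exists>s\<ge>0. b < min (f s) (g s)"
    using s r class_K_mono[OF K(1), of s "max s r"] class_K_mono[OF K(2), of r "max s r"]
    by (intro exI[of _ "max s r"]) auto
qed

lemma class_Kinf_surj:
  assumes "class_Kinf f" "0 \<le> y"
  shows "\<exists>x\<ge>0. f x = y"
proof -
  obtain s where s: "0 \<le> s" "y < f s"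
    using assms(1) by (auto simp: class_Kinf_def)
  have "continuous_on {0..s} f"
    using class_K_cont[OF class_Kinf_K[OF assms(1)]] by (rule continuous_on_subset) auto
  then show ?thesis
    using IVT'[of f 0 y s] s assms class_K_zero[OF class_Kinf_K[OF assms(1)]] by auto
qed

lemma class_Kinf_inv:
  assumes "class_Kinf f" "0 \<le> y"
  shows "0 \<le> inv_into {0..} f y" "f (inv_into {0..} f y) = y"
  using class_Kinf_surj[OF assms] inv_into_into[of y f "{0..}"] f_inv_into_f[of y f "{0..}"]
  by auto

lemma class_Kinf_inv_cancel:
  assumes "class_Kinf f" "0 \<le> x"
  shows "inv_into {0..} f (f x) = x"
proof (rule inv_into_f_f)
  show "inj_on f {0..}"
    by (rule linorder_inj_onI)
      (use class_K_strict[OF class_Kinf_K[OF assms(1)]] in fastforce)+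
qed (use assms in auto)

text \<open>Strict monotonicity turns a tolerance \<open>e\<close> around \<open>g x\<close> into a
  tolerance around \<open>x\<close>, read off from the values of \<open>f\<close> at
  \<open>g x - e\<close> and \<open>g x + e\<close>; this gives continuity of the inverse.\<close>

lemma class_Kinf_inv_Kinf:
  assumes "class_Kinf f"
  shows "class_Kinf (inv_into {0..} f)"
proof -
  define g where "g = inv_into {0..} f"
  note K = class_Kinf_K[OF assms]
  have g: "0 \<le> g y" "f (g y) = y" if "0 \<le> y" for y
    using class_Kinf_inv[OF assms that] by (auto simp: g_def)
  have g': "g (f x) = x" if "0 \<le> x" for x
    using class_Kinf_inv_cancel[OF assms that] by (simp add: g_def)
  have strict: "g x < g y" if "0 \<le> x" "x < y" for x y
    using class_K_cancel[OF K, of "g y" "g x"] g[of x] g[of y] that by simp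
  have "continuous_on {0..} g"
    unfolding continuous_on_iff
  proof (intro ballI allI impI)
    fix x e :: real
    assume x: "x \<in> {0..}" and e: "0 < e"
    define hi where "hi = f (g x + e) - x"
    define lo where "lo = x - f (max 0 (g x - e))"
    have hi: "0 < hi"
      using class_K_strict[OF K, of "g x" "g x + e"] g[of x] x e by (simp add: hi_def)
    \<comment> \<open>If \<open>g x - e\<close> is negative, the lower estimate follows from
      \<open>g\<close> being nonnegative, and only \<open>hi\<close> limits
      \<open>d\<close>.\<close>
    define d where "d = (if g x - e \<ge> 0 then min hi lo else hi)"
    have lo: "0 < lo" if "g x - e \<ge> 0"
      using class_K_strict[OF K, of "g x - e" "g x"] g[of x] x e that by (simp add: lo_def)
    have "dist (g y) (g x) < e" if y: "0 \<le> y" "dist y x < d" for y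
    proof -
      have "f (g y) < f (g x + e)"
        using y g[of y] by (auto simp: d_def hi_def dist_real_def split: if_splits)
      then have 1: "g y < g x + e"
        using class_K_cancel[OF K, of "g x + e" "g y"] g[of x] g[of y] x y e by auto
      have 2: "g x - e < g y"
      proof (cases "g x - e \<ge> 0")
        case True
        then have "f (g x - e) < f (g y)"
          using y g[of y] by (auto simp: d_def lo_def dist_real_def split: if_splits)
        then show ?thesis
          using class_K_cancel[OF K, of "g y" "g x - e"] True g[of y] y by auto
      next
        case False
        then show ?thesis using g[of y] y by auto
      qed
      show ?thesis
        using 1 2 by (auto simp: dist_real_def abs_less_iff)
    qed
    moreover have "0 < d"
      using hi lo by (auto simp: d_def)
    ultimately show "\<exists>d>0. \<forall>y\<in>{0..}. dist y x < d \<longrightarrow> dist (g y) (g x) < e"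
      by auto
  qed
  moreover have "g 0 = 0"
    using g'[of 0] class_K_zero[OF K] by simp
  ultimately have "class_K g"
    using strict by (intro class_KI) auto
  moreover have "\<exists>s\<ge>0. b < g s" for b
    using g'[of "\<bar>b\<bar> + 1"] class_K_nonneg[OF K, of "\<bar>b\<bar> + 1"]
    by (intro exI[of _ "f (\<bar>b\<bar> + 1)"]) auto
  ultimately show ?thesis
    by (simp add: class_Kinf_def g_def)
qed

section \<open>Class K functions built by integration, and the scaling functions \<open>L\<close>
  and \<open>M\<close>\<close>

lemma class_K_primitive_deriv:
  assumes "class_K f" "0 \<le> v"
  shows "((\<lambda>x. integral {0..x} f) has_real_derivative f v) (at v within {0..})"
proof -
  have "continuous_on {0..v + 1} f"
    using class_K_cont[OF assms(1)] by (rule continuous_on_subset) auto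
  then have "((\<lambda>x. integral {0..x} f) has_real_derivative f v) (at v within {0..v + 1})"
    using assms by (intro integral_has_real_derivative) auto
  \<comment> \<open>Near \<open>v\<close> the interval and the half-line coincide; at
    \<open>v = 0\<close> both describe the same one-sided derivative.\<close>
  moreover have "at v within {0..v + 1} = at v within {0..}"
    by (rule at_within_nhd[of _ "{..<v + 1}"]) auto
  ultimately show ?thesis by simp
qed

text \<open>Past 1 the integrand is at least \<open>f 1\<close>, which is positive, so the primitive
  grows at least linearly even if \<open>f\<close> is bounded. This makes \<open>V_sum\<close>
  radially unbounded for scaling functions that are merely of class K.\<close>

lemma class_K_primitive:
  assumes "class_K f"
  shows "class_Kinf (\<lambda>x. integral {0..x} f)"
proof -
  have int: "f integrable_on {a..b}" if "0 \<le> a" for a b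
    by (rule integrable_continuous_real, rule continuous_on_subset[OF class_K_cont[OF assms]])
      (use that in auto)
  have split: "integral {0..y} f = integral {0..x} f + integral {x..y} f"
    if "0 \<le> x" "x \<le> y" for x y
    using Henstock_Kurzweil_Integration.integral_combine[of 0 x y f] int that by simp
  have low: "(y - x) * f x \<le> integral {x..y} f" if "0 \<le> x" "x \<le> y" for x y
    using integral_le[of "\<lambda>_. f x" "{x..y}" f] int[of x y] that
    by (auto intro: class_K_mono[OF assms])
  have nn: "0 \<le> integral {x..y} f" if "0 \<le> x" for x y
    using that by (intro integral_nonneg int) (auto intro: class_K_nonneg[OF assms])
  have K: "class_K (\<lambda>x. integral {0..x} f)"
  proof (rule class_KI)
    show "continuous_on {0..} (\<lambda>x. integral {0..x} f)"
      using class_K_primitive_deriv[OF assms]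
      by (intro DERIV_continuous_on) auto
    fix x y :: real
    assume xy: "0 \<le> x" "x < y"
    \<comment> \<open>The midpoint is used because \<open>f x\<close> vanishes at
      \<open>x = 0\<close>, whereas \<open>f m\<close> is always positive.\<close>
    define m where "m = (x + y) / 2"
    have m: "x < m" "m < y" using xy by (auto simp: m_def)
    have "0 < (y - m) * f m"
      using m xy class_K_pos[OF assms, of m] by simp
    then show "integral {0..x} f < integral {0..y} f"
      using split[of x m] split[of m y] low[of m y] nn[of x m] m xy by simp
  qed simp
  have "\<exists>s\<ge>0. b < integral {0..s} f" for b
  proof -
    have f1: "0 < f 1" using class_K_pos[OF assms] by simp
    define s where "s = 2 + \<bar>b\<bar> / f 1"
    have s: "1 \<le> s" using f1 by (simp add: s_def)
    have "b < (s - 1) * f 1"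
      using f1 by (simp add: s_def field_simps abs_if)
    then show ?thesis
      using split[of 1 s] low[of 1 s] nn[of 0 1] s by (intro exI[of _ s]) auto
  qed
  with K show ?thesis
    by (simp add: class_Kinf_def)
qed

text \<open>The supremum of the admissible \<open>d\<close> is nondecreasing in \<open>x\<close>,
  but it may jump and need not be admissible itself. Its integral is continuous and strictly
  increasing, and a suitable normalisation keeps it strictly below the supremum, where
  \<open>anti\<close> makes every value admissible.\<close>

lemma class_K_selector:
  fixes P :: "real \<Rightarrow> real \<Rightarrow> bool"
  assumes c: "0 < c"
    and ex: "\<And>x. 0 < x \<Longrightarrow> x \<le> c \<Longrightarrow> \<exists>d>0. P x d"
    and anti: "\<And>x d d'. P x d \<Longrightarrow> 0 < d' \<Longrightarrow> d' \<le> d \<Longrightarrow> P x d'"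
    and mono: "\<And>x x' d. P x d \<Longrightarrow> 0 < x \<Longrightarrow> x \<le> x' \<Longrightarrow> x' \<le> c \<Longrightarrow> P x' d"
  obtains k where "class_K k" "\<And>x. 0 < x \<Longrightarrow> x \<le> c \<Longrightarrow> P x (k x)"
proof -
  \<comment> \<open>The cap 1 makes the supremum finite; \<open>min x c\<close> freezes the
    condition beyond \<open>c\<close>, so that \<open>k\<close> exists on the whole
    half-line.\<close>
  define S where "S x = {d. 0 < d \<and> d \<le> 1 \<and> P (min x c) d}" for x
  define d where "d x = (if x \<le> 0 then 0 else Sup (S x))" for x
  have bdd: "bdd_above (S x)" for x
    by (rule bdd_aboveI[of _ 1]) (auto simp: S_def)
  have ne: "S x \<noteq> {}" if x: "0 < x" for x
  proof -
    obtain e where "e > 0" "P (min x c) e"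
      using ex[of "min x c"] x c by auto
    then have "min e 1 \<in> S x"
      using anti[of "min x c" e "min e 1"] by (auto simp: S_def)
    then show ?thesis by blast
  qed
  have pos: "0 < d x" if x: "0 < x" for x
  proof -
    obtain e where "e \<in> S x" using ne[OF x] by blast
    then show ?thesis
      using cSup_upper[of e "S x"] bdd x by (auto simp: d_def S_def)
  qed
  have mon: "d x \<le> d y" if xy: "x \<le> y" for x y
  proof (cases "x \<le> 0")
    case True
    then show ?thesis using pos[of y] by (cases "y \<le> 0") (auto simp: d_def)
  next
    case False
    have "S x \<subseteq> S y"
      using mono[of "min x c" _ "min y c"] xy c False by (auto simp: S_def)
    then show ?thesis
      using cSup_subset_mono[of "S x" "S y"] ne[of x] bdd False xy by (auto simp: d_def)
  qed
  have int: "d integrable_on {a..b}" for a b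
    by (rule integrable_on_mono_on) (auto intro!: mono_onI mon)
  \<comment> \<open>Monotonicity bounds the integral by \<open>x * d x\<close>. Dividing by
    \<open>2 * c\<close> gives at most \<open>d x / 2\<close> for \<open>x \<le> c\<close>; the
    factor 2 provides the strict inequality.\<close>
  define k where "k x = integral {0..x} d / (2 * c)" for x
  have split: "integral {0..y} d = integral {0..x} d + integral {x..y} d"
    if "0 \<le> x" "x \<le> y" for x y
    using Henstock_Kurzweil_Integration.integral_combine[of 0 x y d] int that by simp
  have low: "(y - x) * d x \<le> integral {x..y} d" if "x \<le> y" for x y
    using integral_le[of "\<lambda>_. d x" "{x..y}" d] int[of x y] that by (auto intro: mon)
  have up: "integral {x..y} d \<le> (y - x) * d y" if "x \<le> y" for x y
    using integral_le[of d "{x..y}" "\<lambda>_. d y"] int[of x y] that by (auto intro: mon)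
  have K: "class_K k"
  proof (rule class_KI)
    show "continuous_on {0..} k"
      unfolding continuous_on_eq_continuous_within
    proof
      fix x :: real assume x: "x \<in> {0..}"
      have "continuous_on {0..x + 1} (\<lambda>x. integral {0..x} d)"
        by (rule indefinite_integral_continuous_1[OF int])
      then have "continuous (at x within {0..x + 1}) k"
        using x c unfolding k_def continuous_on_eq_continuous_within by (auto intro!: continuous_intros)
      moreover have "at x within {0..x + 1} = at x within {0..}"
        by (rule at_within_nhd[of _ "{..<x + 1}"]) auto
      ultimately show "continuous (at x within {0..}) k" by simp
    qed
    fix x y :: real
    assume xy: "0 \<le> x" "x < y"
    define m where "m = (x + y) / 2"
    have m: "x < m" "m < y" using xy by (auto simp: m_def)
    have "0 < (y - m) * d m" "0 \<le> (m - x) * d x"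
      using m xy pos[of m] pos[of x] by (auto simp: d_def)
    then have "integral {0..x} d < integral {0..y} d"
      using split[of x m] split[of m y] low[of m y] low[of x m] m xy by simp
    then show "k x < k y"
      using c by (simp add: k_def divide_strict_right_mono)
  qed (simp add: k_def)
  moreover have "P x (k x)" if x: "0 < x" "x \<le> c" for x
  proof -
    have "integral {0..x} d \<le> x * d x"
      using up[of 0 x] x by simp
    also have "\<dots> \<le> c * d x"
      using x pos[of x] by (intro mult_right_mono) auto
    finally have "k x \<le> d x / 2"
      using c by (simp add: k_def field_simps)
    then have "k x < Sup (S x)"
      using pos[OF x(1)] x by (simp add: d_def)
    then obtain e where "e \<in> S x" "k x < e"
      using less_cSup_iff[OF ne[OF x(1)] bdd] by blast
    then show ?thesis
      using anti[of x e "k x"] class_K_pos[OF K x(1)] x by (auto simp: S_def min_def)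
  qed
  ultimately show ?thesis
    using that by blast
qed

text \<open>The function is \<open>M y = y * exp (Q y)\<close> with \<open>Q' u = 1 / k (u / 3) ^ 3\<close>: over a step of
  length \<open>k x\<close> starting in \<open>[x, 2 x]\<close> the exponent grows by at least \<open>1 / (k x)\<^sup>2\<close>.\<close>

lemma class_K_rapid_growth:
  assumes c: "0 < c" and k: "class_K k"
    and k1: "\<And>x. 0 < x \<Longrightarrow> x \<le> c \<Longrightarrow> k x \<le> 1 \<and> k x \<le> x"
  obtains M where "class_K M"
    "\<And>x y. 0 < x \<Longrightarrow> x \<le> c \<Longrightarrow> x \<le> y \<Longrightarrow> y \<le> 2 * x \<Longrightarrow> M y \<le> (k x)\<^sup>2 * M (y + k x)"
proof -
  define q where "q u = 1 / (k (u / 3)) ^ 3" for u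
  have kpos: "0 < k x" if "0 < x" for x
    using class_K_pos[OF k that] .
  have qpos: "0 < q u" if "0 < u" for u
    using kpos[of "u / 3"] that by (simp add: q_def)
  have "isCont q u" if u: "0 < u" for u
  proof -
    have "continuous_on {0<..} (\<lambda>u. k (u / 3))"
      by (rule continuous_on_compose2[OF class_K_cont[OF k]]) (auto intro!: continuous_intros)
    then have "continuous_on {0<..} q"
      using kpos by (auto simp: q_def intro!: continuous_intros) (metis divide_pos_pos less_irrefl zero_less_numeral)
    then show ?thesis
      using u by (simp add: continuous_on_eq_continuous_at)
  qed
  \<comment> \<open>The antiderivative is taken on the open half-line because \<open>q\<close> blows
    up at 0.\<close>
  then obtain Q where Q: "(Q has_vector_derivative q u) (at u)" if "0 < u" for u
    using einterval_antiderivative[of 0 \<infinity> q] by (auto simp: zero_ereal_def)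
  then have Q': "(Q has_real_derivative q u) (at u)" if "0 < u" for u
    using that by (simp add: has_real_derivative_iff_has_vector_derivative)
  have Qmvt: "\<exists>z. x < z \<and> z < y \<and> Q y - Q x = (y - x) * q z" if "0 < x" "x < y" for x y
    using MVT2[of x y Q q] Q' that by auto
  have Qmono: "Q x < Q y" if xy: "0 < x" "x < y" for x y
  proof -
    obtain z where "x < z" "Q y - Q x = (y - x) * q z"
      using Qmvt[OF xy] by blast
    moreover have "0 < (y - x) * q z"
      using qpos[of z] \<open>x < z\<close> xy by simp
    ultimately show ?thesis by simp
  qed
  \<comment> \<open>The factor \<open>y\<close> gives \<open>M 0 = 0\<close> whatever value
    \<open>Q\<close> takes at 0.\<close>
  define M where "M y = y * exp (Q y)" for y
  have "class_K M"
  proof (rule class_KI)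
    show "M x < M y" if xy: "0 \<le> x" "x < y" for x y
    proof (cases "x = 0")
      case False
      then have "exp (Q x) < exp (Q y)" using Qmono xy by simp
      then show ?thesis
        using xy by (auto simp: M_def intro!: mult_strict_mono')
    qed (use xy in \<open>simp add: M_def\<close>)
    show "continuous_on {0..} M"
      unfolding continuous_on_eq_continuous_within
    proof
      fix x :: real assume x: "x \<in> {0..}"
      show "continuous (at x within {0..}) M"
      proof (cases "x = 0")
        case True
        \<comment> \<open>Since \<open>Q\<close> is increasing, \<open>exp (Q y)\<close> stays below
          \<open>exp (Q 1)\<close> near 0, and the factor \<open>y\<close> drives \<open>M\<close>
          to 0.\<close>
        have ev: "\<forall>\<^sub>F y in at 0 within {0..}. norm (M y) \<le> \<bar>y\<bar> * exp (Q 1)"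
          unfolding eventually_at
        proof (intro exI[of _ 1] conjI ballI impI)
          fix y :: real assume y: "y \<in> {0..}" "y \<noteq> 0 \<and> dist y 0 < 1"
          then have "Q y \<le> Q 1"
            using Qmono[of y 1] by simp
          then show "norm (M y) \<le> \<bar>y\<bar> * exp (Q 1)"
            using y by (simp add: M_def abs_mult)
        qed simp
        have "((\<lambda>y. \<bar>y\<bar> * exp (Q 1)) \<longlongrightarrow> \<bar>0\<bar> * exp (Q 1)) (at 0 within {0..})"
          by (intro tendsto_intros)
        then have "(M \<longlongrightarrow> 0) (at 0 within {0..})"
          using Lim_null_comparison[OF ev] by simp
        then show ?thesis
          using True by (simp add: continuous_within M_def)
      next
        case False
        then have "isCont Q x"
          using Q'[of x] x DERIV_isCont by fastforce
        then have "isCont M x"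
          unfolding M_def by (intro continuous_intros)
        then show ?thesis
          using continuous_at_imp_continuous_at_within by blast
      qed
    qed
  qed (simp add: M_def)
  moreover have "M y \<le> (k x)\<^sup>2 * M (y + k x)" if xy: "0 < x" "x \<le> c" "x \<le> y" "y \<le> 2 * x" for x y
  proof -
    have kx: "0 < k x" "k x \<le> 1" "k x \<le> x"
      using k1 kpos xy by auto
    obtain z where z: "y < z" "z < y + k x" "Q (y + k x) - Q y = k x * q z"
      using Qmvt[of y "y + k x"] kx xy by auto
    \<comment> \<open>From \<open>k x \<le> x\<close> and \<open>y \<le> 2 * x\<close> follows
      \<open>z < 3 * x\<close>; this explains the argument \<open>u / 3\<close> in
      \<open>q\<close>.\<close>
    have kz: "0 < k (z / 3)" "k (z / 3) \<le> k x"
      using kpos[of "z / 3"] class_K_mono[OF k, of "z / 3" x] z kx xy by auto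
    \<comment> \<open>The step length uses up one of the three powers of \<open>1 / k x\<close>; two
      remain for the growth factor.\<close>
    have "1 / (k x) ^ 2 = k x * (1 / (k x) ^ 3)"
      using kx by (simp add: power2_eq_square power3_eq_cube)
    also have "\<dots> \<le> k x * q z"
      unfolding q_def using kz kx by (intro mult_left_mono divide_left_mono power_mono) auto
    also have "\<dots> \<le> exp (Q (y + k x) - Q y)"
      unfolding z(3) using exp_ge_add_one_self[of "k x * q z"] by linarith
    finally have "exp (Q y) \<le> (k x)\<^sup>2 * exp (Q (y + k x))"
      using kx by (simp add: exp_diff field_simps)
    then have "y * exp (Q y) \<le> (y + k x) * ((k x)\<^sup>2 * exp (Q (y + k x)))"
      using kx xy by (intro mult_mono) auto
    then show ?thesis
      by (simp add: M_def mult.left_commute)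
  qed
  ultimately show ?thesis
    using that by blast
qed

text \<open>Take \<open>L v = M (X v + k (X v))\<close> halfway into the gap between \<open>X v\<close> and the points \<open>Y\<close> with
  \<open>\<tau> * g (X v) < g Y\<close>, where \<open>M\<close> grows fast enough on both halves of the gap. The second requirement
  is void for \<open>v \<ge> w\<close>, so there \<open>L\<close> can be increased at will to meet the first one.\<close>

lemma scaling_functions:
  assumes X: "class_K X" and g: "class_K g" and D: "class_K D"
    and tau: "1 < \<tau>" and w: "0 < w" and B: "0 \<le> B"
    and sup: "\<And>s. 0 \<le> s \<Longrightarrow> g s \<le> \<tau> * g (X w)"
  obtains L M where "class_K L" "class_K M"
    "\<And>v. 0 \<le> v \<Longrightarrow> M (X v) * (X v)\<^sup>2 \<le> L v * D v"
    "\<And>v Y. 0 \<le> v \<Longrightarrow> 0 \<le> Y \<Longrightarrow> \<tau> * g (X v) < g Y \<Longrightarrow> B * L v \<le> M Y * (Y - X v)"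
proof -
  \<comment> \<open>The construction by rapid growth has to cover \<open>v \<le> w + 1\<close>, one
    unit past \<open>w\<close>, because the correction \<open>E\<close> takes full effect only from
    \<open>w + 1\<close> on.\<close>
  define c where "c = X (w + 1)"
  have c: "0 < c"
    using class_K_pos[OF X] w by (simp add: c_def)
  \<comment> \<open>The bounds by 1 and \<open>x\<close> are those of the rapid growth lemma, and
    \<open>B * d \<le> 2\<close> absorbs the constant \<open>B\<close>. The condition on
    \<open>g\<close> says that the gap above \<open>x'\<close> has length at least
    \<open>2 * d\<close>; the one on \<open>D\<close> serves the first requirement. Both range over
    all larger points, which makes \<open>P\<close> monotone in \<open>x\<close>.\<close>
  define P where "P x d \<longleftrightarrow> d \<le> 1 \<and> d \<le> x \<and> B * d \<le> 2 \<and>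
      (\<forall>x'. x \<le> x' \<longrightarrow> x' \<le> c \<longrightarrow> g (x' + 2 * d) \<le> \<tau> * g x') \<and>
      (\<forall>v\<ge>0. x \<le> X v \<longrightarrow> d * c\<^sup>2 \<le> D v)" for x d
  have ex: "\<exists>d>0. P x d" if x: "0 < x" "x \<le> c" for x
  proof -
    \<comment> \<open>Uniform continuity gives one step size for all \<open>x'\<close> in
      \<open>[x, c]\<close>; the increase allowed for \<open>g\<close> is smallest at
      \<open>x'\<close> equal to \<open>x\<close>, namely \<open>(\<tau> - 1) * g x\<close>.\<close>
    have "uniformly_continuous_on {0..c + 2} g"
      by (rule compact_uniformly_continuous, rule continuous_on_subset[OF class_K_cont[OF g]]) auto
    moreover have gx: "0 < (\<tau> - 1) * g x"
      using tau class_K_pos[OF g x(1)] by simp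
    ultimately obtain d1 where d1: "0 < d1"
      "\<And>x' y. x' \<in> {0..c + 2} \<Longrightarrow> y \<in> {0..c + 2} \<Longrightarrow> dist y x' < d1 \<Longrightarrow> dist (g y) (g x') < (\<tau> - 1) * g x"
      unfolding uniformly_continuous_on_def by blast
    have "continuous_on {0..w + 1} X"
      by (rule continuous_on_subset[OF class_K_cont[OF X]]) auto
    then obtain v where v: "0 \<le> v" "X v = x"
      using IVT'[of X 0 x "w + 1"] x w class_K_zero[OF X] by (auto simp: c_def)
    have v0: "0 < v"
      using v x class_K_zero[OF X] by (cases "v = 0") auto
    \<comment> \<open>Each entry serves one clause of \<open>P\<close>: \<open>2 / (B + 1)\<close>
      also covers \<open>B = 0\<close>, \<open>d1 / 4\<close> keeps the displacement
      \<open>2 * d\<close> below \<open>d1\<close>, and \<open>v\<close> is the smallest point at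
      which \<open>X\<close> reaches \<open>x\<close>.\<close>
    define d where "d = Min {1, x, 2 / (B + 1), d1 / 4, D v / c\<^sup>2}"
    have pos: "0 < d"
      using x c B d1 class_K_pos[OF D v0] by (simp add: d_def)
    have le: "d \<le> 1" "d \<le> x" "d \<le> 2 / (B + 1)" "d \<le> d1 / 4" "d \<le> D v / c\<^sup>2"
      unfolding d_def by (rule Min_le; simp)+
    have "d * (B + 1) \<le> 2"
      using le(3) B by (simp add: field_simps)
    then have "B * d \<le> 2"
      using pos by (simp add: field_simps)
    moreover have "g (x' + 2 * d) \<le> \<tau> * g x'" if x': "x \<le> x'" "x' \<le> c" for x'
    proof -
      have "dist (g (x' + 2 * d)) (g x') < (\<tau> - 1) * g x"
        using x' x pos le d1(1) by (intro d1(2)) (auto simp: dist_real_def)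
      also have "\<dots> \<le> (\<tau> - 1) * g x'"
        using class_K_mono[OF g] x x' tau by (intro mult_left_mono) auto
      finally show ?thesis
        by (simp add: dist_real_def algebra_simps)
    qed
    moreover have "d * c\<^sup>2 \<le> D u" if u: "0 \<le> u" "x \<le> X u" for u
    proof -
      have "v \<le> u"
        using class_K_strict[OF X u(1), of v] u v by fastforce
      then have "D v \<le> D u"
        using class_K_mono[OF D v(1)] by simp
      moreover have "d * c\<^sup>2 \<le> D v"
        using le(5) c by (simp add: field_simps)
      ultimately show ?thesis by simp
    qed
    ultimately show ?thesis
      using pos le unfolding P_def by blast
  qed
  have anti: "P x d'" if "P x d" "0 < d'" "d' \<le> d" for x d d'
    unfolding P_def
  proof (intro conjI allI impI)
    show "B * d' \<le> 2"
      using that B mult_left_mono[of d' d B] by (auto simp: P_def)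
    show "g (x' + 2 * d') \<le> \<tau> * g x'" if x': "x \<le> x'" "x' \<le> c" for x'
    proof -
      have "0 \<le> x'" using x' \<open>P x d\<close> \<open>0 < d'\<close> \<open>d' \<le> d\<close> by (auto simp: P_def)
      then have "g (x' + 2 * d') \<le> g (x' + 2 * d)"
        using \<open>0 < d'\<close> \<open>d' \<le> d\<close> by (intro class_K_mono[OF g]) auto
      then show ?thesis
        using \<open>P x d\<close> x' by (force simp: P_def)
    qed
    show "d' * c\<^sup>2 \<le> D v" if "0 \<le> v" "x \<le> X v" for v
      using \<open>P x d\<close> that mult_right_mono[OF \<open>d' \<le> d\<close>, of "c\<^sup>2"] by (force simp: P_def)
  qed (use that in \<open>auto simp: P_def\<close>)
  have mono: "P x' d" if "P x d" "0 < x" "x \<le> x'" "x' \<le> c" for x x' d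
    using that by (auto simp: P_def)
  obtain k where k: "class_K k" and kP: "\<And>x. 0 < x \<Longrightarrow> x \<le> c \<Longrightarrow> P x (k x)"
    by (rule class_K_selector[of c P]) (rule c | erule (1) ex | erule (2) anti | erule (3) mono | blast)+
  have k1: "k x \<le> 1 \<and> k x \<le> x" if "0 < x" "x \<le> c" for x
    using kP[OF that] by (simp add: P_def)
  obtain M where M: "class_K M" and grow:
    "\<And>x y. 0 < x \<Longrightarrow> x \<le> c \<Longrightarrow> x \<le> y \<Longrightarrow> y \<le> 2 * x \<Longrightarrow> M y \<le> (k x)\<^sup>2 * M (y + k x)"
    using class_K_rapid_growth[OF c k k1] by blast
  \<comment> \<open>The cutoff vanishes up to \<open>w\<close>, where the second requirement is
    active, and is at least 1 from \<open>w + 1\<close> on. There \<open>D w \<le> D v\<close> makes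
    \<open>E\<close> alone sufficient for the first requirement.\<close>
  define E where "E v = max 0 (v - w) * (M (X v) * (X v)\<^sup>2 / D w)" for v
  define L where "L v = M (X v + k (X v)) + E v" for v
  have MX: "class_K (\<lambda>v. M (X v))"
    by (rule class_K_comp[OF M X])
  have Dw: "0 < D w"
    using class_K_pos[OF D w] .
  have "class_SN E"
    unfolding class_SN_def
  proof (intro conjI allI impI)
    show "continuous_on {0..} E"
      unfolding E_def using Dw
      by (intro continuous_intros class_K_cont[OF MX] class_K_cont[OF X]) auto
    show "mono_on {0..} E"
      unfolding E_def using Dw class_K_mono[OF MX] class_K_mono[OF X] class_K_nonneg[OF MX]
        class_K_nonneg[OF X]
      by (intro mono_onI mult_mono divide_right_mono power_mono) (auto simp: max_def)
    show "0 \<le> E v" if "0 \<le> v" for v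
      using Dw class_K_nonneg[OF MX that] by (simp add: E_def)
  qed
  moreover have "class_K (\<lambda>v. M (X v + k (X v)))"
    using class_K_comp[OF M class_K_add[OF X class_K_SN[OF class_K_comp[OF k X]]]]
      class_K_zero[OF X] class_K_zero[OF k] by simp
  moreover have "E 0 = 0"
    using w by (simp add: E_def)
  ultimately have L: "class_K L"
    unfolding L_def by (simp add: class_K_add)
  have Enn: "0 \<le> E v" if "0 \<le> v" for v
    using \<open>class_SN E\<close> class_SN_nonneg that by blast
  have "M (X v) * (X v)\<^sup>2 \<le> L v * D v" if v: "0 \<le> v" for v
  proof -
    consider "v = 0" | "0 < v" "v \<le> w + 1" | "w + 1 < v" using v by linarith
    then show ?thesis
    proof cases
      case 1
      then show ?thesis using class_K_zero[OF X] class_K_zero[OF D] by simp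
    next
      case 2
      define x where "x = X v"
      have x: "0 < x" "x \<le> c"
        using class_K_pos[OF X 2(1)] class_K_mono[OF X v 2(2)] by (auto simp: x_def c_def)
      have kx: "0 < k x" "k x \<le> 1"
        using class_K_pos[OF k x(1)] k1[OF x] by auto
      have kD: "k x * c\<^sup>2 \<le> D v"
        using kP[OF x] v by (simp add: P_def x_def)
      have Mk: "0 \<le> M (x + k x)"
        using x kx by (intro class_K_nonneg[OF M]) auto
      \<comment> \<open>A single factor \<open>k x\<close> is enough here; together with
        \<open>c\<^sup>2\<close> it is dominated by \<open>D v\<close>.\<close>
      have "(k x)\<^sup>2 \<le> k x"
        using kx by (simp add: power2_eq_square)
      then have "M x \<le> k x * M (x + k x)"
        using grow[of x x] x mult_right_mono[OF _ Mk, of "(k x)\<^sup>2" "k x"] by simp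
      then have "M x * x\<^sup>2 \<le> (k x * M (x + k x)) * c\<^sup>2"
        using x kx Mk by (intro mult_mono power_mono) auto
      also have "\<dots> = M (x + k x) * (k x * c\<^sup>2)"
        by simp
      also have "\<dots> \<le> M (x + k x) * D v"
        using kD Mk by (rule mult_left_mono)
      also have "\<dots> \<le> L v * D v"
        using Enn[OF v] class_K_nonneg[OF D v] by (intro mult_right_mono) (auto simp: L_def x_def)
      finally show ?thesis by (simp add: x_def)
    next
      case 3
      have nn: "0 \<le> M (X v) * (X v)\<^sup>2 / D w"
        using Dw class_K_nonneg[OF MX v] by simp
      have "1 * (M (X v) * (X v)\<^sup>2 / D w) \<le> E v"
        unfolding E_def by (rule mult_right_mono[OF _ nn]) (use 3 in auto)
      moreover have "0 \<le> M (X v + k (X v))"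
        using class_K_nonneg[OF X v] class_K_nonneg[OF k]
        by (intro class_K_nonneg[OF M] add_nonneg_nonneg) auto
      ultimately have "M (X v) * (X v)\<^sup>2 / D w \<le> L v"
        by (simp add: L_def)
      then have "M (X v) * (X v)\<^sup>2 \<le> L v * D w"
        using Dw by (simp add: field_simps)
      also have "\<dots> \<le> L v * D v"
        using class_K_mono[OF D, of w v] 3 w class_K_nonneg[OF L v] by (intro mult_left_mono) auto
      finally show ?thesis .
    qed
  qed
  moreover have "B * L v \<le> M Y * (Y - X v)" if v: "0 \<le> v" and Y: "0 \<le> Y" and gY: "\<tau> * g (X v) < g Y" for v Y
  proof -
    have Xv: "0 \<le> X v" using class_K_nonneg[OF X v] .
    have MY: "0 \<le> M Y" using class_K_nonneg[OF M Y] .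
    have vw: "v < w"
    proof (rule ccontr)
      assume "\<not> v < w"
      then have "g (X w) \<le> g (X v)"
        using class_K_mono[OF X, of w v] class_K_nonneg[OF X, of w] w
        by (intro class_K_mono[OF g]) auto
      then have "\<tau> * g (X w) \<le> \<tau> * g (X v)"
        using tau by simp
      then show False
        using sup[OF Y] gY by simp
    qed
    show ?thesis
    proof (cases "v = 0")
      case True
      then show ?thesis
        using class_K_zero[OF X] class_K_zero[OF L] MY Y by simp
    next
      case False
      define x where "x = X v"
      have x: "0 < x" "x \<le> c"
        using class_K_pos[OF X, of v] class_K_mono[OF X v, of "w + 1"] vw v False
        by (auto simp: x_def c_def)
      have kx: "0 < k x" "k x \<le> x"
        using class_K_pos[OF k x(1)] k1[OF x] by auto
      have Bk: "B * k x \<le> 2" and gk: "g (x + 2 * k x) \<le> \<tau> * g x"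
        using kP[OF x] x by (auto simp: P_def)
      \<comment> \<open>The clause \<open>gk\<close> puts every \<open>Y\<close> with
        \<open>\<tau> * g x < g Y\<close> beyond the full gap \<open>2 * k x\<close>.\<close>
      have Yx: "x + 2 * k x < Y"
        using class_K_cancel[OF g Y, of "x + 2 * k x"] gk gY kx x by (simp add: x_def)
      have "L v = M (x + k x)"
        using vw by (simp add: L_def E_def x_def)
      \<comment> \<open>This is growth across the second half of the gap. Of the two factors
        \<open>k x\<close>, one cancels \<open>B\<close> and the other becomes the distance
        \<open>Y - x\<close>.\<close>
      also have "\<dots> \<le> (k x)\<^sup>2 * M (x + k x + k x)"
        using x kx by (intro grow) auto
      also have "\<dots> \<le> (k x)\<^sup>2 * M Y"
        using x kx Yx by (intro mult_left_mono class_K_mono[OF M]) auto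
      finally have "B * L v \<le> B * ((k x)\<^sup>2 * M Y)"
        using B by (rule mult_left_mono)
      also have "\<dots> = (B * k x) * (k x * M Y)"
        by (simp add: power2_eq_square)
      also have "\<dots> \<le> 2 * (k x * M Y)"
        using Bk kx MY by (intro mult_right_mono) auto
      also have "\<dots> = M Y * (2 * k x)"
        by simp
      also have "\<dots> \<le> M Y * (Y - x)"
        using MY Yx by (intro mult_left_mono) auto
      finally show ?thesis by (simp add: x_def)
    qed
  qed
  ultimately show ?thesis
    using that L M by blast
qed

text \<open>This is the pointwise dissipation estimate with \<open>l\<close>, \<open>a\<close>,
  \<open>A\<close>, \<open>x\<close> and \<open>b\<close> standing for \<open>L v\<close>,
  \<open>\<alpha>3 s\<close>, \<open>A s\<close>, \<open>X v\<close> and \<open>a3\<close>. For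
  \<open>Y \<le> x\<close> the first summand is negative enough, by \<open>low\<close>, to absorb
  the second. For \<open>Y > x\<close> the second is negative, and \<open>high\<close> lets half of
  it pay for the first whenever the gain condition does not.\<close>

lemma cross_term_domination:
  assumes M: "class_K M" and g: "class_K g"
    and pos: "0 \<le> l" "0 \<le> a" "0 \<le> A" "0 \<le> x" "0 < b" "0 < \<rho>" "\<rho> \<le> 1"
    and tau: "1 < \<tau>'" "\<tau>' < \<tau>" and \<kappa>: "\<kappa> = (1 - \<tau>' / \<tau>) / 2"
    and r: "\<rho> * Y \<le> r" "r \<le> Y" "0 \<le> r"
    and a: "\<tau> * (A * g x) \<le> a"
    and low: "2 * b * (M x * x\<^sup>2) \<le> \<kappa> * (l * a)"
    and high: "\<tau>' * g x < g Y \<Longrightarrow> 2 * A * l * g Y \<le> b * \<rho>\<^sup>2 * M Y * Y * (Y - x)"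
  shows "l * (- a + A * g Y) + M Y * (- b * r * (r - \<rho> * x))
           \<le> - (\<kappa> * (l * a)) - b * \<rho>\<^sup>2 / 4 * (M (Y / 2) * Y\<^sup>2)"
proof -
  have Y: "0 \<le> Y" using r by simp
  have MY: "0 \<le> M Y" "0 \<le> M x" "0 \<le> M (Y / 2)" "M (Y / 2) \<le> M Y"
    using class_K_nonneg[OF M] class_K_mono[OF M, of "Y / 2" Y] Y pos by auto
  have \<rho>2: "\<rho>\<^sup>2 \<le> 1" "0 < \<rho>\<^sup>2"
    using pos by (auto simp: power_le_one)
  have la: "0 \<le> l * a" using pos by simp
  \<comment> \<open>Up to the threshold \<open>\<tau>' * g x\<close> the gain condition leaves the
    fraction \<open>1 - \<tau>' / \<tau>\<close>, that is \<open>2 * \<kappa>\<close>, of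
    \<open>a\<close>. One \<open>\<kappa>\<close> is kept in the conclusion, the other is available
    for the remaining terms.\<close>
  have first: "l * (- a + A * g Y) \<le> - (2 * \<kappa> * (l * a))" if "g Y \<le> \<tau>' * g x"
  proof -
    have "A * g Y \<le> A * (\<tau>' * g x)"
      using that pos by (intro mult_left_mono) auto
    also have "\<dots> = (\<tau>' / \<tau>) * (\<tau> * (A * g x))"
      using tau by simp
    also have "\<dots> \<le> (\<tau>' / \<tau>) * a"
      using a tau by (intro mult_left_mono) auto
    finally have "A * g Y \<le> (\<tau>' / \<tau>) * a" .
    moreover have "2 * \<kappa> * a = a - (\<tau>' / \<tau>) * a"
      by (simp add: \<kappa> left_diff_distrib)
    ultimately have "- a + A * g Y \<le> - (2 * \<kappa> * a)"
      by linarith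
    then have "l * (- a + A * g Y) \<le> l * (- (2 * \<kappa> * a))"
      using pos by (intro mult_left_mono) auto
    then show ?thesis by (simp add: algebra_simps)
  qed
  have \<kappa>pos: "0 < \<kappa>" "2 * \<kappa> \<le> 1"
    using tau by (auto simp: \<kappa>)
  show ?thesis
  proof (cases "Y \<le> x")
    case True
    have "g Y \<le> g x" using class_K_mono[OF g Y True] .
    also have "\<dots> \<le> \<tau>' * g x"
      using tau class_K_nonneg[OF g, of x] pos mult_right_mono[of 1 \<tau>' "g x"] by simp
    finally have 1: "l * (- a + A * g Y) \<le> - (2 * \<kappa> * (l * a))" by (rule first)
    have MYx: "M Y \<le> M x" using class_K_mono[OF M Y True] .
    \<comment> \<open>Completing the square bounds the possible increase of the second summand,
      which is largest at \<open>r = \<rho> * x / 2\<close>.\<close>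
    have "0 \<le> (r - \<rho> * x / 2)\<^sup>2" by simp
    then have "- (r * (r - \<rho> * x)) \<le> \<rho>\<^sup>2 * x\<^sup>2 / 4"
      by (simp add: power2_eq_square algebra_simps)
    also have "\<dots> \<le> x\<^sup>2"
      using \<rho>2 mult_right_mono[of "\<rho>\<^sup>2" 4 "x\<^sup>2"] by simp
    finally have "b * (- (r * (r - \<rho> * x))) \<le> b * x\<^sup>2"
      using pos by (intro mult_left_mono) auto
    then have "M Y * (b * (- (r * (r - \<rho> * x)))) \<le> M Y * (b * x\<^sup>2)"
      using MY(1) by (rule mult_left_mono)
    also have "\<dots> \<le> M x * (b * x\<^sup>2)"
      using MYx pos by (intro mult_right_mono) auto
    finally have 2: "M Y * (- b * r * (r - \<rho> * x)) \<le> b * (M x * x\<^sup>2)"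
      by (simp add: algebra_simps)
    have "M (Y / 2) * Y\<^sup>2 \<le> M x * x\<^sup>2"
      using MY MYx True Y by (intro mult_mono power_mono) auto
    moreover have "b * \<rho>\<^sup>2 / 4 \<le> b"
      using pos \<rho>2 mult_left_mono[of "\<rho>\<^sup>2" 4 b] by simp
    ultimately have "b * \<rho>\<^sup>2 / 4 * (M (Y / 2) * Y\<^sup>2) \<le> b * (M x * x\<^sup>2)"
      by - (rule mult_mono; use pos MY in auto)
    then show ?thesis
      using 1 2 low by linarith
  next
    case False
    then have xY: "x < Y" by simp
    \<comment> \<open>This decrease of the second summand is guaranteed by
      \<open>\<rho> * Y \<le> r\<close>. One half goes to the first summand, the other to the term
      in \<open>Y\<close> of the conclusion.\<close>
    define G where "G = b * \<rho>\<^sup>2 * M Y * Y * (Y - x)"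
    have "\<rho> * Y * (\<rho> * (Y - x)) \<le> r * (r - \<rho> * x)"
      using r pos xY Y by (intro mult_mono) (auto simp: algebra_simps)
    then have "M Y * (b * (\<rho> * Y * (\<rho> * (Y - x)))) \<le> M Y * (b * (r * (r - \<rho> * x)))"
      using MY pos by (intro mult_left_mono) auto
    then have 2: "M Y * (- b * r * (r - \<rho> * x)) \<le> - G"
      by (simp add: G_def power2_eq_square algebra_simps)
    have G0: "0 \<le> G"
      using pos MY Y xY by (simp add: G_def)
    have 3: "l * (- a + A * g Y) \<le> - (2 * \<kappa> * (l * a)) + G / 2"
    proof (cases "g Y \<le> \<tau>' * g x")
      case True
      then show ?thesis using first G0 by simp
    next
      case False
      then have "2 * A * l * g Y \<le> G" using high by (simp add: G_def)
      then have "l * (- a + A * g Y) \<le> - (l * a) + G / 2"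
        by (simp add: algebra_simps)
      moreover have "2 * \<kappa> * (l * a) \<le> 1 * (l * a)"
        using \<kappa>pos la by (intro mult_right_mono) auto
      ultimately show ?thesis by simp
    qed
    \<comment> \<open>For \<open>Y \<le> 2 * x\<close> the bound \<open>low\<close> controls the
      term, because \<open>M\<close> is evaluated at \<open>Y / 2\<close>; otherwise
      \<open>Y - x \<ge> Y / 2\<close> and \<open>G / 2\<close> suffices.\<close>
    have 4: "b * \<rho>\<^sup>2 / 4 * (M (Y / 2) * Y\<^sup>2) \<le> \<kappa> * (l * a) + G / 2"
    proof (cases "Y / 2 \<le> x")
      case True
      have "M (Y / 2) * (Y / 2)\<^sup>2 \<le> M x * x\<^sup>2"
        using MY True Y class_K_mono[OF M, of "Y / 2" x] by (intro mult_mono power_mono) auto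
      then have "M (Y / 2) * Y\<^sup>2 \<le> 4 * (M x * x\<^sup>2)"
        by (simp add: power_divide)
      moreover have "b * \<rho>\<^sup>2 / 4 \<le> b / 4"
        using pos \<rho>2 mult_left_mono[of "\<rho>\<^sup>2" 1 b] by simp
      ultimately have "b * \<rho>\<^sup>2 / 4 * (M (Y / 2) * Y\<^sup>2) \<le> b / 4 * (4 * (M x * x\<^sup>2))"
        by - (rule mult_mono; use pos MY in auto)
      moreover have "0 \<le> b * (M x * x\<^sup>2)"
        using pos MY by simp
      ultimately show ?thesis using low G0 by linarith
    next
      case False
      have "b * \<rho>\<^sup>2 * (M (Y / 2) * Y) * (Y / 2) \<le> b * \<rho>\<^sup>2 * (M Y * Y) * (Y - x)"
        using False pos MY Y by (intro mult_mono) auto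
      then have "b * \<rho>\<^sup>2 / 4 * (M (Y / 2) * Y\<^sup>2) \<le> G / 2"
        by (simp add: G_def power2_eq_square algebra_simps)
      moreover have "0 \<le> \<kappa> * (l * a)" using \<kappa>pos la by simp
      ultimately show ?thesis by linarith
    qed
    show ?thesis using 2 3 4 by linarith
  qed
qed

section \<open>C^1 functions of time and state, and the sum-type function\<close>

lemma C1_time_state_continuous:
  assumes "C1_time_state V Vt Vx"
  shows "continuous_on ({0..} \<times> UNIV) (\<lambda>p. V (fst p) (snd p))"
  unfolding continuous_on_eq_continuous_within
  using assms by (auto simp: C1_time_state_def intro!: has_derivative_continuous)

text \<open>The chain rule is applied within \<open>{0..}\<close>: nonnegativity keeps
  \<open>V\<close> in the half-line on which \<open>L\<close> is controlled, and at
  \<open>V t z = 0\<close> the outer derivative is one-sided.\<close>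

lemma C1_time_state_primitive:
  assumes V: "C1_time_state V Vt Vx" and nn: "\<And>t z. 0 \<le> t \<Longrightarrow> 0 \<le> V t z" and L: "class_K L"
  shows "C1_time_state (\<lambda>t z. integral {0..V t z} L)
    (\<lambda>t z. L (V t z) * Vt t z) (\<lambda>t z. L (V t z) *\<^sub>R Vx t z)"
proof -
  have contL: "continuous_on ({0..} \<times> UNIV) (\<lambda>p. L (V (fst p) (snd p)))"
    by (rule continuous_on_compose2[OF class_K_cont[OF L] C1_time_state_continuous[OF V]])
      (use nn in auto)
  have "((\<lambda>p. integral {0..V (fst p) (snd p)} L) has_derivative
      (\<lambda>h. fst h * (L (V t z) * Vt t z) + (L (V t z) *\<^sub>R Vx t z) \<bullet> snd h))
      (at (t, z) within {0..} \<times> UNIV)" if t: "0 \<le> t" for t z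
  proof -
    have der: "((\<lambda>v. integral {0..v} L) has_derivative (\<lambda>h. L v * h)) (at v within {0..})"
      if "v \<in> {0..}" for v
      using class_K_primitive_deriv[OF L, of v] that
      by (simp add: has_field_derivative_def)
    have "((\<lambda>p. integral {0..V (fst p) (snd p)} L) has_derivative
        (\<lambda>h. L (V (fst (t, z)) (snd (t, z))) * (fst h * Vt t z + Vx t z \<bullet> snd h)))
        (at (t, z) within {0..} \<times> UNIV)"
      by (rule has_derivative_in_compose2[OF der])
        (use V nn t in \<open>auto simp: C1_time_state_def\<close>)
    then show ?thesis
      by (simp add: algebra_simps)
  qed
  moreover have "continuous_on ({0..} \<times> UNIV) (\<lambda>p. L (V (fst p) (snd p)) * Vt (fst p) (snd p))"
    "continuous_on ({0..} \<times> UNIV) (\<lambda>p. L (V (fst p) (snd p)) *\<^sub>R Vx (fst p) (snd p))"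
    using V contL by (auto simp: C1_time_state_def intro!: continuous_on_mult continuous_on_scaleR)
  ultimately show ?thesis
    by (simp add: C1_time_state_def)
qed

text \<open>It lifts a function of one component to the product state: \<open>P\<close> is a
  projection and its adjoint \<open>Q\<close> the embedding that fills the other component with 0,
  so \<open>Q\<close> maps gradients to gradients.\<close>

lemma C1_time_state_linear:
  assumes V: "C1_time_state V Vt Vx" and P: "bounded_linear P" and Q: "bounded_linear Q"
    and adj: "\<And>x h. x \<bullet> P h = Q x \<bullet> h"
  shows "C1_time_state (\<lambda>t z. V t (P z)) (\<lambda>t z. Vt t (P z)) (\<lambda>t z. Q (Vx t (P z)))"
proof -
  let ?f = "\<lambda>p. (fst p, P (snd p))"
  have contf: "continuous_on ({0..} \<times> UNIV) ?f"
    by (intro continuous_intros bounded_linear.continuous_on[OF P])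
  have "((\<lambda>p. V (fst (?f p)) (snd (?f p))) has_derivative
      (\<lambda>h. fst (?f h) * Vt (fst (?f (t, z))) (snd (?f (t, z)))
        + Vx (fst (?f (t, z))) (snd (?f (t, z))) \<bullet> snd (?f h)))
      (at (t, z) within {0..} \<times> UNIV)" if t: "0 \<le> t" for t z
  proof (rule has_derivative_in_compose2[where g = "\<lambda>p. V (fst p) (snd p)" and f = ?f and f' = ?f
        and g' = "\<lambda>q h. fst h * Vt (fst q) (snd q) + Vx (fst q) (snd q) \<bullet> snd h"])
    show "((\<lambda>p. V (fst p) (snd p)) has_derivative
        (\<lambda>h. fst h * Vt (fst q) (snd q) + Vx (fst q) (snd q) \<bullet> snd h))
        (at q within {0..} \<times> UNIV)" if "q \<in> {0..} \<times> UNIV" for q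
      using V that by (cases q) (auto simp: C1_time_state_def)
    show "(?f has_derivative ?f) (at (t, z) within {0..} \<times> UNIV)"
      by (intro has_derivative_Pair has_derivative_fst has_derivative_ident
          bounded_linear.has_derivative[OF P] has_derivative_snd)
  qed (use t in auto)
  moreover have "continuous_on ({0..} \<times> UNIV) (\<lambda>p. Vt (fst (?f p)) (snd (?f p)))"
    by (rule continuous_on_compose2[where g = "\<lambda>p. Vt (fst p) (snd p)", OF _ contf])
      (use V in \<open>auto simp: C1_time_state_def\<close>)
  moreover have "continuous_on ({0..} \<times> UNIV) (\<lambda>p. Vx (fst (?f p)) (snd (?f p)))"
    by (rule continuous_on_compose2[where g = "\<lambda>p. Vx (fst p) (snd p)", OF _ contf])
      (use V in \<open>auto simp: C1_time_state_def\<close>)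
  ultimately show ?thesis
    by (auto simp: C1_time_state_def adj intro: bounded_linear.continuous_on[OF Q])
qed

lemma C1_time_state_add:
  assumes V: "C1_time_state V Vt Vx" and U: "C1_time_state U Ut Ux"
  shows "C1_time_state (\<lambda>t z. V t z + U t z) (\<lambda>t z. Vt t z + Ut t z) (\<lambda>t z. Vx t z + Ux t z)"
  unfolding C1_time_state_def
proof (intro conjI allI impI)
  fix t :: real and z :: 'a assume t: "0 \<le> t"
  have "((\<lambda>p. V (fst p) (snd p)) has_derivative (\<lambda>h. fst h * Vt t z + Vx t z \<bullet> snd h))
      (at (t, z) within {0..} \<times> UNIV)"
    "((\<lambda>p. U (fst p) (snd p)) has_derivative (\<lambda>h. fst h * Ut t z + Ux t z \<bullet> snd h))
      (at (t, z) within {0..} \<times> UNIV)"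
    using V U t by (auto simp: C1_time_state_def)
  from has_derivative_add[OF this]
  show "((\<lambda>p. V (fst p) (snd p) + U (fst p) (snd p)) has_derivative
      (\<lambda>h. fst h * (Vt t z + Ut t z) + (Vx t z + Ux t z) \<bullet> snd h))
      (at (t, z) within {0..} \<times> UNIV)"
    by (simp add: algebra_simps inner_add_left)
qed (use V U in \<open>auto simp: C1_time_state_def intro: continuous_on_add\<close>)

lemma C1_time_state_V_sum:
  fixes V :: "real \<Rightarrow> real^'n \<Rightarrow> real" and U :: "real \<Rightarrow> real^'q \<Rightarrow> real"
  assumes "C1_time_state V Vt Vx" "\<And>t z. 0 \<le> t \<Longrightarrow> 0 \<le> V t z" "class_K L"
    and "C1_time_state U Ut Ux" "\<And>t z. 0 \<le> t \<Longrightarrow> 0 \<le> U t z" "class_K M"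
  shows "C1_time_state (V_sum L M V U)
    (\<lambda>t z. L (V t (fst z)) * Vt t (fst z) + M (U t (snd z)) * Ut t (snd z))
    (\<lambda>t z. (L (V t (fst z)) *\<^sub>R Vx t (fst z), M (U t (snd z)) *\<^sub>R Ux t (snd z)))"
proof -
  have "V_sum L M V U = (\<lambda>t z. integral {0..V t (fst z)} L + integral {0..U t (snd z)} M)"
    by (auto simp: V_sum_def fun_eq_iff)
  moreover have "C1_time_state (\<lambda>t z. integral {0..V t (fst z)} L)
      (\<lambda>t z. L (V t (fst z)) * Vt t (fst z)) (\<lambda>t z. (L (V t (fst z)) *\<^sub>R Vx t (fst z), 0::real^'q))"
    by (rule C1_time_state_linear[OF C1_time_state_primitive[OF assms(1-3)] bounded_linear_fst])
      (auto intro!: bounded_linear_Pair bounded_linear_ident bounded_linear_zero simp: inner_prod_def)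
  moreover have "C1_time_state (\<lambda>t z. integral {0..U t (snd z)} M)
      (\<lambda>t z. M (U t (snd z)) * Ut t (snd z)) (\<lambda>t z. (0::real^'n, M (U t (snd z)) *\<^sub>R Ux t (snd z)))"
    by (rule C1_time_state_linear[OF C1_time_state_primitive[OF assms(4-6)] bounded_linear_snd])
      (auto intro!: bounded_linear_Pair bounded_linear_ident bounded_linear_zero simp: inner_prod_def)
  ultimately show ?thesis
    using C1_time_state_add by fastforce
qed

text \<open>Each component has norm at most \<open>norm z\<close>, which gives the upper bound. At
  least one has norm at least \<open>norm z / 2\<close>; hence the minimum and the halved argument
  in \<open>b1\<close>.\<close>

lemma V_sum_bounds:
  assumes V: "\<And>t z. 0 \<le> t \<Longrightarrow> \<alpha>1 (norm z) \<le> V t z \<and> V t z \<le> \<alpha>2 (norm z)"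
    and U: "\<And>t z. 0 \<le> t \<Longrightarrow> \<beta>1 (norm z) \<le> U t z \<and> U t z \<le> \<beta>2 (norm z)"
    and K: "class_Kinf \<alpha>1" "class_Kinf \<alpha>2" "class_Kinf \<beta>1" "class_Kinf \<beta>2"
    and LM: "class_K L" "class_K M"
  obtains b1 b2 where "class_Kinf b1" "class_Kinf b2"
    "\<And>t z. 0 \<le> t \<Longrightarrow> b1 (norm z) \<le> V_sum L M V U t z \<and> V_sum L M V U t z \<le> b2 (norm z)"
proof -
  define I J where "I v = integral {0..v} L" and "J v = integral {0..v} M" for v
  have IJ: "class_Kinf I" "class_Kinf J"
    using LM[THEN class_K_primitive] by (auto simp: I_def[abs_def] J_def[abs_def])
  have half: "class_Kinf (\<lambda>s. s / 2)"
    unfolding class_Kinf_def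
  proof (intro conjI allI)
    show "class_K (\<lambda>s. s / 2)"
      using class_K_scale[OF class_K_id, of "1 / 2"] by simp
    show "\<exists>s\<ge>0. b < s / 2" for b :: real
      by (rule exI[of _ "2 * (\<bar>b\<bar> + 1)"]) auto
  qed
  define b1 where "b1 s = min (I (\<alpha>1 (s / 2))) (J (\<beta>1 (s / 2)))" for s
  define b2 where "b2 s = I (\<alpha>2 s) + J (\<beta>2 s)" for s
  note Imono = class_K_mono[OF class_Kinf_K[OF IJ(1)]] class_K_mono[OF class_Kinf_K[OF IJ(2)]]
  note Inn = class_K_nonneg[OF class_Kinf_K[OF IJ(1)]] class_K_nonneg[OF class_Kinf_K[OF IJ(2)]]
  note nn = K[THEN class_Kinf_K, THEN class_K_nonneg]
  note mono = K[THEN class_Kinf_K, THEN class_K_mono]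
  have "class_Kinf b1"
    unfolding b1_def using K IJ half
    by (intro class_Kinf_min class_Kinf_comp[of I "\<lambda>s. \<alpha>1 (s / 2)"]
        class_Kinf_comp[of J "\<lambda>s. \<beta>1 (s / 2)"] class_Kinf_comp[of \<alpha>1 "\<lambda>s. s / 2"]
        class_Kinf_comp[of \<beta>1 "\<lambda>s. s / 2"])
  moreover have "class_Kinf b2"
    unfolding b2_def
    by (intro class_Kinf_add class_Kinf_K[OF class_Kinf_comp[OF IJ(2) K(4)]]
        class_Kinf_comp[OF IJ(1) K(2)])
  moreover have "b1 (norm z) \<le> V_sum L M V U t z \<and> V_sum L M V U t z \<le> b2 (norm z)"
    if t: "0 \<le> t" for t z
  proof -
    obtain e p where z: "z = (e, p)" by (cases z)
    have le: "norm e \<le> norm z" "norm p \<le> norm z"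
      using norm_fst_le[of e p] norm_snd_le[of p e] by (simp_all add: z)
    have tri: "norm z \<le> norm e + norm p"
      using norm_Pair_le[of e p] by (simp add: z)
    have eq: "V_sum L M V U t z = I (V t e) + J (U t p)"
      by (simp add: V_sum_def z I_def J_def)
    have V0: "0 \<le> V t e" "0 \<le> U t p"
      using V[OF t, of e] U[OF t, of p] nn(1)[of "norm e"] nn(3)[of "norm p"] by auto
    have "V t e \<le> \<alpha>2 (norm z)" "U t p \<le> \<beta>2 (norm z)"
      using V[OF t, of e] U[OF t, of p] mono(2)[OF _ le(1)] mono(4)[OF _ le(2)] by force+
    then have "V_sum L M V U t z \<le> b2 (norm z)"
      using Imono V0 by (simp add: eq b2_def add_mono)
    moreover have "b1 (norm z) \<le> V_sum L M V U t z"
    proof (cases "norm z / 2 \<le> norm e")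
      case True
      then have "\<alpha>1 (norm z / 2) \<le> V t e"
        using V[OF t, of e] mono(1)[of "norm z / 2" "norm e"] by simp
      then have "I (\<alpha>1 (norm z / 2)) \<le> I (V t e)"
        by (intro Imono nn) auto
      then show ?thesis
        using Inn(2)[OF V0(2)] by (simp add: b1_def eq)
    next
      case False
      then have "\<beta>1 (norm z / 2) \<le> U t p"
        using U[OF t, of p] mono(3)[of "norm z / 2" "norm p"] tri by simp
      then have "J (\<beta>1 (norm z / 2)) \<le> J (U t p)"
        by (intro Imono nn) auto
      then show ?thesis
        using Inn(1)[OF V0(1)] by (simp add: b1_def eq)
    qed
    ultimately show ?thesis by simp
  qed
  ultimately show ?thesis
    using that by blast
qed

section \<open>Saturation, and the closed loop in error coordinates\<close>

lemma satv_eq_self: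
  fixes p :: "real^'q"
  assumes "norm p \<le> ls"
  shows "satv ls eps p = p"
  using assms component_le_norm_cart[of p]
  by (auto simp: satv_def sat_def vec_eq_iff intro: order_trans)

lemma satv_in_sat_box:
  assumes "0 \<le> ls" "0 < eps"
  shows "satv ls eps p \<in> sat_box ls eps"
proof -
  have "\<bar>sat ls eps s\<bar> \<le> ls + eps / 2" for s
  proof -
    \<comment> \<open>On the transition piece the modulus of the saturated value is governed by
      \<open>ls + (u - u\<^sup>2 / (2 * eps))\<close>. Fact \<open>1\<close> gives its sign, and
      \<open>(u - eps)\<^sup>2 \<ge> 0\<close> its upper bound.\<close>
    define u where "u = \<bar>s\<bar> - ls"
    consider "\<bar>s\<bar> \<le> ls" | "ls < \<bar>s\<bar>" "\<bar>s\<bar> \<le> ls + eps" | "ls + eps < \<bar>s\<bar>" by linarith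
    then show ?thesis
    proof cases
      case 2
      then have u: "0 < u" "u \<le> eps" by (auto simp: u_def)
      have "u\<^sup>2 \<le> eps * u"
        using u by (simp add: power2_eq_square mult_right_mono)
      then have 1: "u\<^sup>2 / (2 * eps) \<le> u / 2"
        using assms by (simp add: field_simps)
      have "0 \<le> (u - eps)\<^sup>2" by simp
      then have "u * (2 * eps) - u\<^sup>2 \<le> eps / 2 * (2 * eps)"
        by (simp add: power2_eq_square algebra_simps)
      then have 2: "u - u\<^sup>2 / (2 * eps) \<le> eps / 2"
        using assms by (simp add: field_simps)
      have "sat ls eps s = sgn s * (ls + (u - u\<^sup>2 / (2 * eps)))"
        using 2 u assms by (auto simp: sat_def u_def sgn_if algebra_simps)
      then have "\<bar>sat ls eps s\<bar> \<le> \<bar>ls + (u - u\<^sup>2 / (2 * eps))\<bar>"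
        by (simp add: abs_mult abs_sgn_eq)
      then show ?thesis
        using 1 2 u assms by linarith
    qed (use assms in \<open>auto simp: sat_def abs_mult abs_sgn_eq\<close>)
  qed
  then show ?thesis
    by (simp add: sat_box_def satv_def)
qed

text \<open>Convexity permits the mean value inequality for \<open>\<phi>\<close> between two
  saturated parameters. The box is an intersection of coordinate half-spaces.\<close>

lemma convex_sat_box: "convex (sat_box ls eps)"
proof -
  have eq: "sat_box ls eps = (\<Inter>i. {p. p $ i \<le> ls + eps / 2} \<inter> {p. p $ i \<ge> - (ls + eps / 2)})"
    by (auto simp: sat_box_def abs_le_iff) (smt (verit))+
  have "convex ({p. p $ i \<le> ls + eps / 2} \<inter> {p. p $ i \<ge> - (ls + eps / 2)})" for i :: 'a
    using convex_halfspace_le[of "axis i 1" "ls + eps / 2"]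
      convex_halfspace_ge[of "- (ls + eps / 2)" "axis i 1"]
    by (intro convex_Int) (simp_all add: cart_eq_inner_axis inner_commute)
  then show ?thesis
    unfolding eq by (rule convex_INT)
qed

text \<open>The \<open>beta_xr\<close> terms of the estimator and of the coordinate change cancel,
  and \<open>beta_e\<close> multiplies only the mismatch between \<open>\<phi> p\<close> and its
  estimate. The remaining \<open>- \<sigma> x *v phi_s\<close> at the plant state \<open>x\<close>
  is its value at the reference, contained in \<open>H_est\<close>, minus \<open>Delta\<close>.
  Since \<open>p\<close> is not saturated, the plant term is the one occurring in
  \<open>phi_s\<close>.\<close>

lemma closed_loop_eq:
  assumes beta: "\<And>e y. ((\<lambda>e. beta \<sigma> e y) has_derivative (\<lambda>h. \<sigma> (e + y) *v h)) (at e)"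
    and p: "satv ls eps p = p"
  shows "closed_loop f1 \<phi> g1 \<psi> \<sigma> lt ls eps kdz xr dxr p t (e, p') =
    (F_err f1 \<phi> g1 \<psi> (xr t) (dxr t) (satv ls eps (p + p')) e - phi_s \<phi> ls eps p p' (e + xr t),
     H_est \<phi> \<sigma> lt ls eps kdz p p' (xr t) - Delta \<phi> \<sigma> ls eps p p' (xr t) e)"
proof -
  have "beta_e \<sigma> e (xr t) = \<sigma> (e + xr t)"
    by (simp add: beta_e_def frechet_derivative_at[OF beta, symmetric])
  then show ?thesis
    by (simp add: closed_loop_def controller_def plant_def estimator_def F_err_def
        phi_s_def H_est_def Delta_def varphi_def p Let_def add.commute[of p' p]
        matrix_vector_mult_diff_distrib matrix_vector_right_distrib algebra_simps)
qed

text \<open>The displayed equations and the actual closed loop differ in the sign of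
  \<open>Delta\<close>; one pair of scaling functions serves both. The hypothesis
  \<open>beta\<close> expresses that the integral defining \<open>beta\<close> is a potential of
  \<open>\<sigma>\<close>.\<close>

theorem corollary1:
  fixes \<Theta> :: "(real^'q) set"
    and f1 :: "real^'n \<Rightarrow> real^'n"
    and \<phi> :: "real^'q \<Rightarrow> real^'n \<Rightarrow> real^'n"
    and D\<phi> :: "real^'q \<Rightarrow> real^'n \<Rightarrow> real^'q^'n"
    and g1 :: "real^'n \<Rightarrow> real^'m^'n"
    and \<psi> :: "real^'n \<Rightarrow> real^'n \<Rightarrow> real^'q \<Rightarrow> real^'n \<Rightarrow> real^'m"
    and \<sigma> :: "real^'n \<Rightarrow> real^'n^'q"
    and M1 :: "real^'n \<Rightarrow> real^'q^'q"
    and xr dxr :: "real \<Rightarrow> real^'n"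
    and lt ls eps kdz r1 \<delta> \<mu> l\<gamma> a1 a2 a3 a4 astar \<tau> :: real
    and \<alpha>1 \<alpha>2 \<alpha>3 \<alpha>4 \<gamma> \<kappa>1 \<kappa>2 :: "real \<Rightarrow> real"
    and Verr Verr_t :: "real \<Rightarrow> real^'n \<Rightarrow> real" and Verr_e :: "real \<Rightarrow> real^'n \<Rightarrow> real^'n"
    and Vest Vest_t :: "real \<Rightarrow> real^'q \<Rightarrow> real" and Vest_p :: "real \<Rightarrow> real^'q \<Rightarrow> real^'q"
  assumes Theta: "compact \<Theta>" "\<Theta> \<noteq> {}" "\<And>p. p \<in> \<Theta> \<Longrightarrow> norm p \<le> lt"
    and eps: "0 < eps" "eps \<le> 1"
    and kdz: "0 < kdz"
    and phi_C1: "\<And>p x. ((\<lambda>p. \<phi> p x) has_derivative (\<lambda>h. D\<phi> p x *v h)) (at p)"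
      "\<And>x. continuous_on UNIV (\<lambda>p. D\<phi> p x)"
    and ref: "\<And>t. 0 \<le> t \<Longrightarrow> (xr has_vector_derivative dxr t) (at t within {0..})"
      "continuous_on {0..} dxr" "0 < r1" "\<And>t. 0 \<le> t \<Longrightarrow> norm (xr t) \<le> r1"
    and ls: "sqrt (real CARD('q)) * lt < ls"
    and sigma: "continuous_on UNIV \<sigma>"
    and M1: "continuous_on UNIV M1"
      "\<And>t p p'. 0 \<le> t \<Longrightarrow> p \<in> \<Theta> \<Longrightarrow> norm p' \<le> ls \<Longrightarrow>
         (p' - p) \<bullet> (M1 (xr t) *v (p' - p)) \<le> (p' - p) \<bullet> (\<sigma> (xr t) *v (\<phi> p' (xr t) - \<phi> p (xr t)))"
      "\<And>t p p'. 0 \<le> t \<Longrightarrow> p \<in> \<Theta> \<Longrightarrow> norm p' \<le> ls \<Longrightarrow>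
         0 \<le> (p' - p) \<bullet> (M1 (xr t) *v (p' - p))"
    and excitation: "0 < \<delta>" "0 < \<mu>"
      "\<And>t v. 0 \<le> t \<Longrightarrow>
         \<mu> * (v \<bullet> v) \<le> v \<bullet> (integral {t..t + \<delta>} (\<lambda>s. M1 (xr s) + transpose (M1 (xr s))) *v v)"
    and beta: "\<And>e y. ((\<lambda>e. beta \<sigma> e y) has_derivative (\<lambda>h. \<sigma> (e + y) *v h)) (at e)"
    and alphas: "class_Kinf \<alpha>1" "class_Kinf \<alpha>2" "class_Kinf \<alpha>3" "class_Kinf \<alpha>4"
    and equilibrium: "\<And>t p. 0 \<le> t \<Longrightarrow> F_err f1 \<phi> g1 \<psi> (xr t) (dxr t) p 0 = 0"
    and Verr: "C1_time_state Verr Verr_t Verr_e"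
      "\<And>t e. 0 \<le> t \<Longrightarrow> \<alpha>1 (norm e) \<le> Verr t e \<and> Verr t e \<le> \<alpha>2 (norm e)"
      "\<And>t e p. 0 \<le> t \<Longrightarrow>
         Verr_t t e + Verr_e t e \<bullet> F_err f1 \<phi> g1 \<psi> (xr t) (dxr t) p e \<le> - \<alpha>3 (norm e)"
      "\<And>t e. 0 \<le> t \<Longrightarrow> norm (Verr_e t e) \<le> \<alpha>4 (norm e)"
    and gamma: "class_K \<gamma>" "\<not> class_Kinf \<gamma>" "0 < l\<gamma>"
      "\<And>s. 0 \<le> s \<Longrightarrow> \<gamma> s \<le> l\<gamma> \<and> \<gamma> s \<le> s"
      "\<And>p p'. p \<in> \<Theta> \<Longrightarrow> norm (satv ls eps (p + p') - p) \<le> \<gamma> (norm p')"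
    and kappa1: "class_SN \<kappa>1"
      "\<And>s p y e. 0 \<le> s \<Longrightarrow> p \<in> sat_box ls eps \<Longrightarrow> norm y \<le> r1 \<Longrightarrow> norm e \<le> s \<Longrightarrow>
         onorm (\<lambda>h. D\<phi> p (e + y) *v h) \<le> \<kappa>1 s"
    and kappa2: "class_K \<kappa>2"
      "\<And>y e p p'. norm y \<le> r1 \<Longrightarrow> p \<in> sat_box ls eps \<Longrightarrow> p' \<in> sat_box ls eps \<Longrightarrow>
         norm (varphi \<phi> \<sigma> p y (e + y) - varphi \<phi> \<sigma> p' y (e + y)) \<le> \<kappa>2 (norm e) * norm (p - p')"
    and a_pos: "0 < a1" "0 < a2" "0 < a3" "0 < a4"
    and astar: "astar = sqrt a2 * a4 / (sqrt a1 * a3)"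
    and Vest: "C1_time_state Vest Vest_t Vest_p"
      "\<And>t p'. 0 \<le> t \<Longrightarrow> a1 * (norm p')\<^sup>2 \<le> Vest t p' \<and> Vest t p' \<le> a2 * (norm p')\<^sup>2"
      "\<And>t p p'. 0 \<le> t \<Longrightarrow> p \<in> \<Theta> \<Longrightarrow>
         Vest_t t p' + Vest_p t p' \<bullet> H_est \<phi> \<sigma> lt ls eps kdz p p' (xr t) \<le> - a3 * (norm p')\<^sup>2"
      "\<And>t p'. 0 \<le> t \<Longrightarrow> norm (Vest_p t p') \<le> a4 * norm p'"
    and gain: "4 < \<tau>"
      "\<And>s. 0 \<le> s \<Longrightarrow>
         \<tau> * \<gamma> (astar * l\<gamma> * \<kappa>2 (inv_into {0..} \<alpha>1 (\<alpha>2 s))) * \<alpha>4 s * \<kappa>1 s \<le> \<alpha>3 s"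
    (* the gain does not level off below sup \<gamma>; automatic if \<kappa>2 is unbounded *)
    and gain_infinity:
      "\<exists>s0\<ge>0. \<forall>s\<ge>0. \<gamma> s \<le> \<tau> * \<gamma> (astar * l\<gamma> * \<kappa>2 (inv_into {0..} \<alpha>1 (\<alpha>2 s0)))"
  shows "\<exists>lam_err lam_est. class_K lam_err \<and> class_K lam_est \<and>
    strict_lyapunov \<Theta> (error_system f1 \<phi> g1 \<psi> \<sigma> lt ls eps kdz xr dxr)
      (V_sum lam_err lam_est Verr Vest) \<and>
    strict_lyapunov \<Theta> (closed_loop f1 \<phi> g1 \<psi> \<sigma> lt ls eps kdz xr dxr)
      (V_sum lam_err lam_est Verr Vest)"
proof -

  \<comment> \<open>Constants and comparison functions of the error system\<close>
  define \<rho> where "\<rho> = sqrt a1 / sqrt a2"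
  define X where "X v = astar * l\<gamma> * \<kappa>2 (inv_into {0..} \<alpha>1 v)" for v
  define A where "A s = \<alpha>4 s * \<kappa>1 s" for s
  note \<alpha>K = alphas[THEN class_Kinf_K]
  have g: "class_K \<gamma>" by (rule gamma(1))
  have lt: "0 \<le> lt"
    using Theta(2,3) norm_ge_zero order_trans by blast
  have "1 * lt \<le> sqrt (real CARD('q)) * lt"
    using lt by (intro mult_right_mono) (auto simp: Suc_le_eq)
  then have lts: "lt < ls" using ls by simp
  have satp: "satv ls eps p = p" if "p \<in> \<Theta>" for p
    using Theta(3)[OF that] lts by (intro satv_eq_self) simp
  have box: "satv ls eps p \<in> sat_box ls eps" for p :: "real^'q"
    using lt lts eps by (intro satv_in_sat_box) auto

  \<comment> \<open>Evaluating the two bounds on \<open>Vest\<close> at a unit vector compares the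
    constants.\<close>
  have "a1 \<le> a2"
    using Vest(2)[of 0 "axis undefined 1"] by simp
  then have \<rho>: "0 < \<rho>" "\<rho> \<le> 1"
    using a_pos by (auto simp: \<rho>_def)
  \<comment> \<open>With this identity the perturbation term
    \<open>a4 * r * l\<gamma> * \<kappa>2\<close> takes the form
    \<open>a3 * r * (\<rho> * X v)\<close>, so the estimate for \<open>Vest\<close> factors.\<close>
  have \<rho>star: "a3 * \<rho> * astar = a4" and star: "0 < astar"
    using a_pos by (auto simp: \<rho>_def astar field_simps)
  have inv1: "0 \<le> inv_into {0..} \<alpha>1 v" "\<alpha>1 (inv_into {0..} \<alpha>1 v) = v" if "0 \<le> v" for v
    using class_Kinf_inv[OF alphas(1) that] .
  have inv1_mono: "inv_into {0..} \<alpha>1 u \<le> inv_into {0..} \<alpha>1 v" if "0 \<le> u" "u \<le> v" for u v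
    by (rule class_K_mono[OF class_Kinf_K[OF class_Kinf_inv_Kinf[OF alphas(1)]] that])
  have X: "class_K X"
    unfolding X_def using star gamma(3)
    by (intro class_K_scale class_K_comp[OF kappa2(1)] class_Kinf_K class_Kinf_inv_Kinf alphas) simp
  have Ann: "0 \<le> A s" if "0 \<le> s" for s
    using class_K_nonneg[OF \<alpha>K(4) that] class_SN_nonneg[OF kappa1(1) that] by (simp add: A_def)
  have Amono: "A s \<le> A s'" if "0 \<le> s" "s \<le> s'" for s s'
    unfolding A_def
    using class_K_mono[OF \<alpha>K(4) that] class_SN_mono[OF kappa1(1) that]
      class_K_nonneg[OF \<alpha>K(4)] class_SN_nonneg[OF kappa1(1)] that
    by (intro mult_mono) auto

  \<comment> \<open>Relaxed gain and choice of the scaling functions\<close>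
  obtain s0 where s0: "0 \<le> s0" "\<And>s. 0 \<le> s \<Longrightarrow> \<gamma> s \<le> \<tau> * \<gamma> (X (\<alpha>2 s0))"
    using gain_infinity by (auto simp: X_def)
  define v0 where "v0 = \<alpha>2 s0"
  have v0: "0 \<le> v0"
    using class_K_nonneg[OF \<alpha>K(2) s0(1)] by (simp add: v0_def)
  have gX: "0 \<le> \<gamma> (X v0)" "\<gamma> (X v0) < \<gamma> (X (v0 + 1))"
    using class_K_nonneg[OF class_K_comp[OF g X] v0]
      class_K_strict[OF class_K_comp[OF g X] v0, of "v0 + 1"] by auto
  \<comment> \<open>The first entry keeps \<open>\<tau>'\<close> above 1. The second makes
    \<open>\<tau>' * \<gamma> (X (v0 + 1))\<close> a bound for \<open>\<gamma>\<close>; it is below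
    \<open>\<tau>\<close> because \<open>\<gamma> (X v)\<close> increases strictly from
    \<open>v0\<close> to \<open>v0 + 1\<close>. The surplus of \<open>\<tau>\<close> over
    \<open>\<tau>'\<close> becomes \<open>\<kappa>\<close>.\<close>
  define \<tau>' where "\<tau>' = max ((1 + \<tau>) / 2) (\<tau> * (\<gamma> (X v0) / \<gamma> (X (v0 + 1))))"
  have "\<tau> * (\<gamma> (X v0) / \<gamma> (X (v0 + 1))) < \<tau> * 1"
    using gX gain(1) by (intro mult_strict_left_mono) auto
  then have tau: "1 < \<tau>'" "\<tau>' < \<tau>"
    using gain(1) by (auto simp: \<tau>'_def less_max_iff_disj)
  have sup: "\<gamma> s \<le> \<tau>' * \<gamma> (X (v0 + 1))" if "0 \<le> s" for s
  proof -
    have "\<tau> * (\<gamma> (X v0) / \<gamma> (X (v0 + 1))) * \<gamma> (X (v0 + 1)) \<le> \<tau>' * \<gamma> (X (v0 + 1))"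
      using gX by (intro mult_right_mono) (auto simp: \<tau>'_def)
    then show ?thesis
      using s0(2)[OF that] gX by (simp add: v0_def)
  qed
  define \<kappa> where "\<kappa> = (1 - \<tau>' / \<tau>) / 2"
  have \<kappa>: "0 < \<kappa>"
    using tau by (simp add: \<kappa>_def)
  \<comment> \<open>Since \<open>v \<le> \<alpha>2 s\<close>, this is a lower bound in terms of
    \<open>v\<close> for a multiple of \<open>\<alpha>3 s\<close>; the factor is the one required by
    \<open>low\<close> in the domination lemma.\<close>
  define D where "D v = \<kappa> / (2 * a3) * \<alpha>3 (inv_into {0..} \<alpha>2 v)" for v
  have D: "class_K D"
    unfolding D_def using \<kappa> a_pos
    by (intro class_K_scale class_K_comp[OF \<alpha>K(3)] class_Kinf_K class_Kinf_inv_Kinf alphas) simp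
  \<comment> \<open>\<open>Ab\<close> bounds \<open>A s\<close> for every \<open>e\<close> with
    \<open>Verr t e \<le> v0 + 1\<close>, and \<open>B\<close> is scaled so that
    \<open>2 * Ab = a3 * \<rho>\<^sup>2 * B\<close>.\<close>
  define Ab where "Ab = A (inv_into {0..} \<alpha>1 (v0 + 1))"
  define B where "B = 2 * Ab / (a3 * \<rho>\<^sup>2)"
  have "0 \<le> B"
    using Ann[OF inv1(1), of "v0 + 1"] v0 a_pos by (simp add: B_def Ab_def)
  moreover have "0 < v0 + 1" using v0 by simp
  ultimately obtain L M where L: "class_K L" and M: "class_K M"
    and low: "\<And>v. 0 \<le> v \<Longrightarrow> M (X v) * (X v)\<^sup>2 \<le> L v * D v"
    and high: "\<And>v Y. 0 \<le> v \<Longrightarrow> 0 \<le> Y \<Longrightarrow> \<tau>' * \<gamma> (X v) < \<gamma> Y \<Longrightarrow> B * L v \<le> M Y * (Y - X v)"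
    using scaling_functions[OF X g D tau(1) _ _ sup] by blast

  \<comment> \<open>This reparametrisation makes \<open>N (Vest t p')\<close> equal to
    \<open>M Y\<close>.\<close>
  define N where "N v = M (sqrt (v / a1))" for v
  have "class_K (\<lambda>v. sqrt (v / a1))"
    using a_pos by (intro class_KI) (auto intro!: continuous_intros simp: divide_strict_right_mono)
  then have N: "class_K N"
    unfolding N_def by (rule class_K_comp[OF M])
  have Vnn: "0 \<le> Verr t e" "0 \<le> Vest t p'" if "0 \<le> t" for t e p'
  proof -
    have "0 \<le> \<alpha>1 (norm e)" "0 \<le> a1 * (norm p')\<^sup>2"
      using class_K_nonneg[OF \<alpha>K(1)] a_pos by simp_all
    then show "0 \<le> Verr t e" "0 \<le> Vest t p'"
      using Verr(2)[OF that, of e] Vest(2)[OF that, of p'] by linarith+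
  qed

  \<comment> \<open>The decrease function \<open>W\<close>\<close>
  define W :: "(real^'n) \<times> (real^'q) \<Rightarrow> real" where
    "W z = \<kappa> * (L (\<alpha>1 (norm (fst z))) * \<alpha>3 (norm (fst z)))
       + a3 * \<rho>\<^sup>2 / 4 * (M (norm (snd z) / 2) * (norm (snd z))\<^sup>2)" for z
  have W: "pos_def W"
    unfolding pos_def_def
  proof (intro conjI allI impI)
    have "continuous_on UNIV (\<lambda>z::(real^'n) \<times> (real^'q). L (\<alpha>1 (norm (fst z))))"
      by (rule continuous_on_compose2[OF class_K_cont[OF class_K_comp[OF L \<alpha>K(1)]]])
        (auto intro!: continuous_intros)
    moreover have "continuous_on UNIV (\<lambda>z::(real^'n) \<times> (real^'q). \<alpha>3 (norm (fst z)))"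
      by (rule continuous_on_compose2[OF class_K_cont[OF \<alpha>K(3)]]) (auto intro!: continuous_intros)
    moreover have "continuous_on UNIV (\<lambda>z::(real^'n) \<times> (real^'q). M (norm (snd z) / 2))"
      by (rule continuous_on_compose2[OF class_K_cont[OF M]]) (auto intro!: continuous_intros)
    ultimately show "continuous_on UNIV W"
      unfolding W_def
      by (intro continuous_on_add continuous_on_mult continuous_on_const continuous_on_power
          continuous_on_norm continuous_on_snd continuous_on_id)
    show "W 0 = 0"
      by (simp add: W_def class_K_zero[OF \<alpha>K(3)])
    fix z :: "(real^'n) \<times> (real^'q)" assume z: "z \<noteq> 0"
    have nn: "0 \<le> L (\<alpha>1 (norm (fst z))) * \<alpha>3 (norm (fst z))"
      "0 \<le> M (norm (snd z) / 2) * (norm (snd z))\<^sup>2"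
      using class_K_nonneg[OF class_K_comp[OF L \<alpha>K(1)]] class_K_nonneg[OF \<alpha>K(3)] class_K_nonneg[OF M]
      by simp_all
    have c: "0 < a3 * \<rho>\<^sup>2 / 4"
      using a_pos \<rho> by simp
    have "0 < L (\<alpha>1 (norm (fst z))) * \<alpha>3 (norm (fst z)) \<or>
        0 < M (norm (snd z) / 2) * (norm (snd z))\<^sup>2"
      using z class_K_pos[OF class_K_comp[OF L \<alpha>K(1)], of "norm (fst z)"]
        class_K_pos[OF \<alpha>K(3), of "norm (fst z)"] class_K_pos[OF M, of "norm (snd z) / 2"]
      by (auto simp: prod_eq_iff)
    then show "0 < W z"
      unfolding W_def
    proof
      assume "0 < L (\<alpha>1 (norm (fst z))) * \<alpha>3 (norm (fst z))"
      from mult_pos_pos[OF \<kappa> this] mult_nonneg_nonneg[OF less_imp_le[OF c] nn(2)]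
      show "0 < \<kappa> * (L (\<alpha>1 (norm (fst z))) * \<alpha>3 (norm (fst z)))
          + a3 * \<rho>\<^sup>2 / 4 * (M (norm (snd z) / 2) * (norm (snd z))\<^sup>2)"
        by (rule add_pos_nonneg)
    next
      assume "0 < M (norm (snd z) / 2) * (norm (snd z))\<^sup>2"
      from mult_nonneg_nonneg[OF less_imp_le[OF \<kappa>] nn(1)] mult_pos_pos[OF c this]
      show "0 < \<kappa> * (L (\<alpha>1 (norm (fst z))) * \<alpha>3 (norm (fst z)))
          + a3 * \<rho>\<^sup>2 / 4 * (M (norm (snd z) / 2) * (norm (snd z))\<^sup>2)"
        by (rule add_nonneg_pos)
    qed
  qed

  \<comment> \<open>Dissipation along the perturbed error dynamics\<close>
  have phi_lip: "norm (phi_s \<phi> ls eps p p' (e + xr t)) \<le> \<kappa>1 (norm e) * \<gamma> (norm p')"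
    if p: "p \<in> \<Theta>" and t: "0 \<le> t" for p p' e t
  proof -
    \<comment> \<open>Mean value inequality along the segment from \<open>p\<close> to the saturated
      estimate; it stays in the box on which \<open>\<kappa>1\<close> bounds the Jacobian.\<close>
    have "norm (\<phi> (satv ls eps (p + p')) (e + xr t) - \<phi> p (e + xr t))
        \<le> \<kappa>1 (norm e) * norm (satv ls eps (p + p') - p)"
    proof (rule differentiable_bound[OF convex_sat_box])
      show "((\<lambda>p. \<phi> p (e + xr t)) has_derivative (\<lambda>h. D\<phi> q (e + xr t) *v h)) (at q within sat_box ls eps)" for q
        using phi_C1(1) by (rule has_derivative_at_withinI)
      show "onorm (\<lambda>h. D\<phi> q (e + xr t) *v h) \<le> \<kappa>1 (norm e)" if "q \<in> sat_box ls eps" for q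
        using that ref(4)[OF t] by (intro kappa1(2)) auto
      show "p \<in> sat_box ls eps" using box[of p] satp[OF p] by simp
    qed (rule box)
    also have "\<dots> \<le> \<kappa>1 (norm e) * \<gamma> (norm p')"
      using gamma(5)[OF p] class_SN_nonneg[OF kappa1(1)] by (intro mult_left_mono) auto
    finally show ?thesis
      by (simp add: phi_s_def satp[OF p])
  qed

  \<comment> \<open>The perturbation \<open>d\<close> enters only through its norm, so that both
    \<open>Delta\<close> and \<open>- Delta\<close> are covered.\<close>
  have diss: "L (Verr t e) * Verr_t t e + N (Vest t p') * Vest_t t p'
      + (L (Verr t e) *\<^sub>R Verr_e t e, N (Vest t p') *\<^sub>R Vest_p t p')
        \<bullet> (F_err f1 \<phi> g1 \<psi> (xr t) (dxr t) (satv ls eps (p + p')) e - phi_s \<phi> ls eps p p' (e + xr t),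
           H_est \<phi> \<sigma> lt ls eps kdz p p' (xr t) + d) \<le> - W (e, p')"
    if p: "p \<in> \<Theta>" and t: "0 \<le> t" and d: "norm d \<le> l\<gamma> * \<kappa>2 (norm e)" for p p' t e d
  proof -
    define s where "s = norm e"
    define r where "r = norm p'"
    define v where "v = Verr t e"
    define Y where "Y = sqrt (Vest t p' / a1)"
    have s: "0 \<le> s" and r: "0 \<le> r" by (auto simp: s_def r_def)
    have v: "0 \<le> v" "\<alpha>1 s \<le> v" "v \<le> \<alpha>2 s"
      using Vnn(1)[OF t] Verr(2)[OF t, of e] by (auto simp: v_def s_def)
    have Lv: "0 \<le> L v" using class_K_nonneg[OF L v(1)] .
    have Y: "0 \<le> Y" using Vnn(2)[OF t] a_pos by (simp add: Y_def)
    have MY: "0 \<le> M Y" using class_K_nonneg[OF M Y] .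
    have rY: "r \<le> Y"
      unfolding Y_def using Vest(2)[OF t, of p'] a_pos r
      by (intro real_le_rsqrt) (simp add: r_def field_simps)
    have "Y \<le> sqrt (a2 * r\<^sup>2 / a1)"
      unfolding Y_def using Vest(2)[OF t, of p'] a_pos
      by (simp add: r_def divide_right_mono)
    also have "\<dots> = r / \<rho>"
      using r a_pos by (simp add: \<rho>_def real_sqrt_mult real_sqrt_divide)
    finally have Yr: "\<rho> * Y \<le> r"
      using \<rho> by (simp add: field_simps)
    have sv: "s \<le> inv_into {0..} \<alpha>1 v"
      using inv1_mono[of "\<alpha>1 s" v] v class_K_nonneg[OF \<alpha>K(1) s]
      by (simp add: class_Kinf_inv_cancel[OF alphas(1) s])

    have "Verr_e t e \<bullet> (- phi_s \<phi> ls eps p p' (e + xr t)) \<le> norm (Verr_e t e) * norm (phi_s \<phi> ls eps p p' (e + xr t))"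
      using norm_cauchy_schwarz[of "Verr_e t e" "- phi_s \<phi> ls eps p p' (e + xr t)"] by simp
    also have "\<dots> \<le> \<alpha>4 s * (\<kappa>1 s * \<gamma> r)"
      unfolding s_def r_def using Verr(4)[OF t] phi_lip[OF p t] class_K_nonneg[OF \<alpha>K(4)]
      by (intro mult_mono) auto
    also have "\<dots> \<le> A s * \<gamma> Y"
      using class_K_mono[OF g r rY] Ann[OF s] mult_left_mono[of "\<gamma> r" "\<gamma> Y" "A s"] by (simp add: A_def)
    finally have E1: "Verr_t t e + Verr_e t e \<bullet> (F_err f1 \<phi> g1 \<psi> (xr t) (dxr t) (satv ls eps (p + p')) e
        - phi_s \<phi> ls eps p p' (e + xr t)) \<le> - \<alpha>3 s + A s * \<gamma> Y"
      using Verr(3)[OF t, of e "satv ls eps (p + p')"] by (simp add: inner_diff_right s_def)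

    have "Vest_p t p' \<bullet> d \<le> norm (Vest_p t p') * norm d"
      by (rule norm_cauchy_schwarz)
    also have "\<dots> \<le> (a4 * r) * (l\<gamma> * \<kappa>2 s)"
      using Vest(4)[OF t, of p'] d r a_pos by (intro mult_mono) (auto simp: s_def r_def)
    also have "\<dots> \<le> (a4 * r) * (l\<gamma> * \<kappa>2 (inv_into {0..} \<alpha>1 v))"
      using class_K_mono[OF kappa2(1) s sv] a_pos r gamma(3) by (intro mult_left_mono) auto
    also have "\<dots> = a3 * r * (\<rho> * X v)"
      by (simp add: X_def \<rho>star[symmetric])
    finally have E2: "Vest_t t p' + Vest_p t p' \<bullet> (H_est \<phi> \<sigma> lt ls eps kdz p p' (xr t) + d)
        \<le> - a3 * r * (r - \<rho> * X v)"
      using Vest(3)[OF t p, of p'] by (simp add: inner_add_right r_def power2_eq_square algebra_simps)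

    \<comment> \<open>The gain condition is stated at \<open>\<alpha>2 s\<close>; monotonicity and
      \<open>v \<le> \<alpha>2 s\<close> carry it over to \<open>v\<close>.\<close>
    have a: "\<tau> * (A s * \<gamma> (X v)) \<le> \<alpha>3 s"
    proof -
      have "\<gamma> (X v) \<le> \<gamma> (X (\<alpha>2 s))"
        by (rule class_K_mono[OF class_K_comp[OF g X] v(1,3)])
      then have "\<tau> * (A s * \<gamma> (X v)) \<le> \<tau> * (A s * \<gamma> (X (\<alpha>2 s)))"
        using Ann[OF s] gain(1) by (intro mult_left_mono) auto
      also have "\<dots> \<le> \<alpha>3 s"
        using gain(2)[OF s] by (simp add: A_def X_def mult_ac)
      finally show ?thesis .
    qed
    have "inv_into {0..} \<alpha>2 v \<le> s"
      using class_K_mono[OF class_Kinf_K[OF class_Kinf_inv_Kinf[OF alphas(2)]] v(1,3)]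
      by (simp add: class_Kinf_inv_cancel[OF alphas(2) s])
    then have "\<alpha>3 (inv_into {0..} \<alpha>2 v) \<le> \<alpha>3 s"
      using class_Kinf_inv(1)[OF alphas(2) v(1)] by (intro class_K_mono[OF \<alpha>K(3)]) auto
    then have "L v * D v \<le> L v * (\<kappa> / (2 * a3) * \<alpha>3 s)"
      unfolding D_def using Lv \<kappa> a_pos by (intro mult_left_mono) auto
    then have "M (X v) * (X v)\<^sup>2 \<le> L v * (\<kappa> / (2 * a3) * \<alpha>3 s)"
      using low[OF v(1)] by simp
    then have lo: "2 * a3 * (M (X v) * (X v)\<^sup>2) \<le> \<kappa> * (L v * \<alpha>3 s)"
      using a_pos by (simp add: field_simps)
    \<comment> \<open>The premise and \<open>sup\<close> force \<open>v < v0 + 1\<close>, which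
      bounds \<open>s\<close> and makes the constant \<open>Ab\<close> applicable; then
      \<open>\<gamma> Y \<le> Y\<close> brings the term into the form of
      \<open>high\<close>.\<close>
    have hi: "2 * A s * L v * \<gamma> Y \<le> a3 * \<rho>\<^sup>2 * M Y * Y * (Y - X v)" if gY: "\<tau>' * \<gamma> (X v) < \<gamma> Y"
    proof -
      have "\<tau>' * \<gamma> (X v) < \<tau>' * \<gamma> (X (v0 + 1))"
        using gY sup[OF Y] by simp
      then have "v < v0 + 1"
        using class_K_cancel[OF class_K_comp[OF g X], of "v0 + 1" v] v0 v tau by simp
      then have "s \<le> inv_into {0..} \<alpha>1 (v0 + 1)"
        using sv inv1_mono[of v "v0 + 1"] v by simp
      then have "A s \<le> Ab"
        unfolding Ab_def by (rule Amono[OF s])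
      then have "2 * A s * L v * \<gamma> Y \<le> 2 * Ab * L v * Y"
        using Ann[OF s] Lv gamma(4)[OF Y] class_K_nonneg[OF g Y] Y
        by (intro mult_mono) auto
      also have "\<dots> = a3 * \<rho>\<^sup>2 * Y * (B * L v)"
        using a_pos \<rho> by (simp add: B_def)
      also have "\<dots> \<le> a3 * \<rho>\<^sup>2 * Y * (M Y * (Y - X v))"
        using high[OF v(1) Y gY] a_pos Y by (intro mult_left_mono) auto
      finally show ?thesis by (simp add: mult_ac)
    qed
    have "L v * (Verr_t t e + Verr_e t e \<bullet> (F_err f1 \<phi> g1 \<psi> (xr t) (dxr t) (satv ls eps (p + p')) e
          - phi_s \<phi> ls eps p p' (e + xr t)))
        + M Y * (Vest_t t p' + Vest_p t p' \<bullet> (H_est \<phi> \<sigma> lt ls eps kdz p p' (xr t) + d))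
        \<le> L v * (- \<alpha>3 s + A s * \<gamma> Y) + M Y * (- a3 * r * (r - \<rho> * X v))"
      by (intro add_mono mult_left_mono E1 E2 Lv MY)
    also have "\<dots> \<le> - (\<kappa> * (L v * \<alpha>3 s)) - a3 * \<rho>\<^sup>2 / 4 * (M (Y / 2) * Y\<^sup>2)"
      by (rule cross_term_domination[OF M g Lv class_K_nonneg[OF \<alpha>K(3) s] Ann[OF s]
            class_K_nonneg[OF X v(1)] a_pos(3) \<rho> tau \<kappa>_def Yr rY r a lo hi])
    \<comment> \<open>The bounds \<open>\<alpha>1 s \<le> v\<close> and \<open>r \<le> Y\<close>
      remove the dependence on time.\<close>
    also have "\<dots> \<le> - W (e, p')"
    proof -
      have "L (\<alpha>1 s) * \<alpha>3 s \<le> L v * \<alpha>3 s"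
        using v class_K_nonneg[OF \<alpha>K(1) s] class_K_nonneg[OF \<alpha>K(3) s]
        by (intro mult_right_mono class_K_mono[OF L]) auto
      then have "\<kappa> * (L (\<alpha>1 s) * \<alpha>3 s) \<le> \<kappa> * (L v * \<alpha>3 s)"
        using \<kappa> by simp
      moreover have "M (r / 2) * r\<^sup>2 \<le> M (Y / 2) * Y\<^sup>2"
        using rY r class_K_nonneg[OF M, of "Y / 2"] Y
        by (intro mult_mono power_mono class_K_mono[OF M]) auto
      then have "a3 * \<rho>\<^sup>2 / 4 * (M (r / 2) * r\<^sup>2) \<le> a3 * \<rho>\<^sup>2 / 4 * (M (Y / 2) * Y\<^sup>2)"
        using a_pos by (intro mult_left_mono) auto
      ultimately show ?thesis
        by (simp add: W_def s_def r_def)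
    qed
    finally show ?thesis
      by (simp add: v_def N_def Y_def algebra_simps)
  qed

  \<comment> \<open>Saturation bounds the parameter mismatch by \<open>l\<gamma>\<close> however
    large \<open>p'\<close> is, leaving a bound in \<open>e\<close> alone.\<close>
  have Delta_bound: "norm (Delta \<phi> \<sigma> ls eps p p' (xr t) e) \<le> l\<gamma> * \<kappa>2 (norm e)"
    if p: "p \<in> \<Theta>" and t: "0 \<le> t" for p p' t e
  proof -
    have "norm (Delta \<phi> \<sigma> ls eps p p' (xr t) e)
        \<le> \<kappa>2 (norm e) * norm (satv ls eps p - satv ls eps (p + p'))"
      unfolding Delta_def using ref(4)[OF t] by (intro kappa2(2) box)
    also have "norm (satv ls eps p - satv ls eps (p + p')) = norm (satv ls eps (p + p') - p)"
      by (simp add: satp[OF p] norm_minus_commute)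
    also have "\<kappa>2 (norm e) * \<dots> \<le> \<kappa>2 (norm e) * l\<gamma>"
      using gamma(5)[OF p, of p'] gamma(4)[of "norm p'"] class_K_nonneg[OF kappa2(1)]
      by (intro mult_left_mono) auto
    finally show ?thesis by (simp add: mult.commute)
  qed

  \<comment> \<open>Assembling the strict Lyapunov function\<close>
  have sq: "class_Kinf (\<lambda>s. a * s\<^sup>2)" if a: "0 < a" for a :: real
    unfolding class_Kinf_def
  proof (intro conjI allI)
    show "class_K (\<lambda>s. a * s\<^sup>2)"
      using a by (intro class_K_scale class_KI)
        (auto intro!: continuous_intros power_strict_mono)
    fix b
    have "b < a * (\<bar>b\<bar> / a + 1)"
      using a by (simp add: field_simps abs_if)
    also have "\<dots> \<le> a * (\<bar>b\<bar> / a + 1)\<^sup>2"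
      using a by (intro mult_left_mono self_le_power) auto
    finally show "\<exists>s\<ge>0. b < a * s\<^sup>2"
      using a by (intro exI[of _ "\<bar>b\<bar> / a + 1"]) auto
  qed
  obtain b1 b2 where b: "class_Kinf b1" "class_Kinf b2"
    "\<And>t z. 0 \<le> t \<Longrightarrow> b1 (norm z) \<le> V_sum L N Verr Vest t z \<and> V_sum L N Verr Vest t z \<le> b2 (norm z)"
    using V_sum_bounds[of \<alpha>1 Verr \<alpha>2 "\<lambda>s. a1 * s\<^sup>2" Vest "\<lambda>s. a2 * s\<^sup>2" L N,
        OF Verr(2) Vest(2) alphas(1,2) sq[OF a_pos(1)] sq[OF a_pos(2)] L N] by blast
  note C1 = C1_time_state_V_sum[OF Verr(1) Vnn(1) L Vest(1) Vnn(2) N]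
  have lyap: "strict_lyapunov \<Theta> f (V_sum L N Verr Vest)"
    if f: "\<And>p t e p'. p \<in> \<Theta> \<Longrightarrow> 0 \<le> t \<Longrightarrow> \<exists>d. norm d \<le> l\<gamma> * \<kappa>2 (norm e) \<and> f p t (e, p') =
      (F_err f1 \<phi> g1 \<psi> (xr t) (dxr t) (satv ls eps (p + p')) e - phi_s \<phi> ls eps p p' (e + xr t),
       H_est \<phi> \<sigma> lt ls eps kdz p p' (xr t) + d)" for f
    unfolding strict_lyapunov_def
  proof (intro exI conjI ballI allI impI)
    show "C1_time_state (V_sum L N Verr Vest)
      (\<lambda>t z. L (Verr t (fst z)) * Verr_t t (fst z) + N (Vest t (snd z)) * Vest_t t (snd z))
      (\<lambda>t z. (L (Verr t (fst z)) *\<^sub>R Verr_e t (fst z), N (Vest t (snd z)) *\<^sub>R Vest_p t (snd z)))"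
      by (rule C1)
    show "class_Kinf b1" "class_Kinf b2" "pos_def W"
      by (fact b W)+
    show "b1 (norm z) \<le> V_sum L N Verr Vest t z" "V_sum L N Verr Vest t z \<le> b2 (norm z)"
      if "0 \<le> t" for t z
      using b(3)[OF that] by auto
    show "L (Verr t (fst z)) * Verr_t t (fst z) + N (Vest t (snd z)) * Vest_t t (snd z)
        + (L (Verr t (fst z)) *\<^sub>R Verr_e t (fst z), N (Vest t (snd z)) *\<^sub>R Vest_p t (snd z)) \<bullet> f p t z
        \<le> - W z" if p: "p \<in> \<Theta>" and t: "0 \<le> t" for p t z
    proof -
      obtain d where d: "norm d \<le> l\<gamma> * \<kappa>2 (norm (fst z))" and fz: "f p t (fst z, snd z) =
        (F_err f1 \<phi> g1 \<psi> (xr t) (dxr t) (satv ls eps (p + snd z)) (fst z)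
           - phi_s \<phi> ls eps p (snd z) (fst z + xr t),
         H_est \<phi> \<sigma> lt ls eps kdz p (snd z) (xr t) + d)"
        using f[OF p t, of "fst z" "snd z"] by blast
      show ?thesis
        using diss[OF p t d, of "snd z"] fz by simp
    qed
  qed
  have "strict_lyapunov \<Theta> (error_system f1 \<phi> g1 \<psi> \<sigma> lt ls eps kdz xr dxr) (V_sum L N Verr Vest)"
    by (rule lyap) (auto simp: error_system_def intro!: Delta_bound)
  moreover have "strict_lyapunov \<Theta> (closed_loop f1 \<phi> g1 \<psi> \<sigma> lt ls eps kdz xr dxr) (V_sum L N Verr Vest)"
  proof (rule lyap)
    fix p t e p' assume p: "p \<in> \<Theta>" and t: "(0::real) \<le> t"
    let ?d = "- Delta \<phi> \<sigma> ls eps p p' (xr t) e"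
    show "\<exists>d. norm d \<le> l\<gamma> * \<kappa>2 (norm e) \<and> closed_loop f1 \<phi> g1 \<psi> \<sigma> lt ls eps kdz xr dxr p t (e, p') =
      (F_err f1 \<phi> g1 \<psi> (xr t) (dxr t) (satv ls eps (p + p')) e - phi_s \<phi> ls eps p p' (e + xr t),
       H_est \<phi> \<sigma> lt ls eps kdz p p' (xr t) + d)"
      using Delta_bound[OF p t, of p' e] closed_loop_eq[OF beta satp[OF p]]
      by (intro exI[of _ ?d]) simp
  qed
  ultimately show ?thesis
    using L N by blast
qed

end
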